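(* Let $V$ be a simple unitary vertex operator algebra and let $U$ be an energy-bounded unitary subalgebra of $V$ containing the conformal vector $\nu$ of $V$. Assume that $U$ (with conformal vector $\nu$) is a regular vertex operator algebra. Then $V$ is energy-bounded.
   Context: A simple unitary vertex operator algebra is a vertex operator algebra $V$ (over $\mathbb{C}$) of CFT type, i.e. $V=\bigoplus_{n\geq 0}V_n$ with $V_n=\ker(L_0-n1_V)$ and $V_0=\mathbb{C}\Omega$, with vacuum $\Omega$ and conformal vector $\nu$, $Y(\nu,z)=\sum_{n}L_nz^{-n-2}$, equipped with a scalar product $(\cdot|\cdot)$ with $(\Omega|\Omega)=1$ and an antilinear involution $a\mapsto a^*$ with $\nu^*=\nu$ such that $(b|a_nc)=(a^*_{-n}b|c)$ for all $a,b,c\in V$, $n\in\mathbb{Z}$. For $a\in V$ the modes $a_n$ are defined by $Y(z^{L_0}a,z)=\sum_{n}a_nz^{-n}$. Write $\|a\|=\sqrt{(a|a)}$, $V_{\leq n}=\bigoplus_{k\leq n}V_k$, $\|R\|_n:=\sup\{\|Rb\|: b\in V_{\leq n},\|b\|\leq 1\}\in[0,\infty]$. A vector $a$ satisfies energy bounds if there are real $s,C,t\geq0$ with $\|a_m\|_n\leq C(1+|m|)^t(1+|n|)^s$ for all $m,n\in\mathbb{Z}$; $V$ is energy-bounded if every $a\in V$ satisfies energy bounds. A unitary subalgebra of $V$ is a vertex subalgebra $U$ with $L_0U\subset U$ and $U^*=U$; it is energy-bounded if every $a\in U$ satisfies energy bounds. A vertex operator algebra is regular if every weak module is a direct sum of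 irreducible ordinary modules. *)

theory Defs
  imports "HOL-Analysis.Analysis" "HOL-Library.Extended_Nonnegative_Real" "HOL-Library.Function_Algebras"
begin

text \<open>
  Conventions.  A vertex operator algebra is given on a whole type 'v, with an explicit
  complex scalar multiplication sm (so that 'v is a complex vector space via the
  HOL locale vector_space).  Y a n b is the (standard, mathematical) mode a_(n) b, i.e.
  Y(a,z) = sum_n a_(n) z^(-n-1).  Omega is the vacuum, nu the conformal vector,
  L n = nu_(n+1).
\<close>

definition Lop :: "('v \<Rightarrow> int \<Rightarrow> 'v \<Rightarrow> 'v) \<Rightarrow> 'v \<Rightarrow> int \<Rightarrow> 'v \<Rightarrow> 'v" where
  "Lop Y nu n = Y nu (n + 1)"

definition grade ::
  "(complex \<Rightarrow> 'v \<Rightarrow> 'v) \<Rightarrow> ('v \<Rightarrow> int \<Rightarrow> 'v \<Rightarrow> 'v) \<Rightarrow> 'v \<Rightarrow> int \<Rightarrow> 'v set" where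
  "grade sm Y nu n = {a. Lop Y nu 0 a = sm (of_int n) a}"

definition graded_decomp ::
  "(complex \<Rightarrow> 'v::ab_group_add \<Rightarrow> 'v) \<Rightarrow> ('v \<Rightarrow> int \<Rightarrow> 'v \<Rightarrow> 'v) \<Rightarrow> 'v \<Rightarrow> (int \<Rightarrow> 'v) \<Rightarrow> 'v \<Rightarrow> bool" where
  "graded_decomp sm Y nu f a \<longleftrightarrow> finite {d. f d \<noteq> 0} \<and> (\<forall>d. f d \<in> grade sm Y nu d)
      \<and> a = sum f {d. f d \<noteq> 0}"

text \<open>Borcherds (Jacobi) identity for modes; the infinite sums are finite by truncation,
  and we require equality of all sufficiently long partial sums.\<close>
definition borcherds_sums ::
  "(complex \<Rightarrow> 'm::ab_group_add \<Rightarrow> 'm) \<Rightarrow> ('v \<Rightarrow> int \<Rightarrow> 'v \<Rightarrow> 'v) \<Rightarrow> ('v \<Rightarrow> int \<Rightarrow> 'm \<Rightarrow> 'm)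
     \<Rightarrow> 'v \<Rightarrow> 'v \<Rightarrow> 'm \<Rightarrow> int \<Rightarrow> int \<Rightarrow> int \<Rightarrow> nat \<Rightarrow> 'm \<times> 'm" where
  "borcherds_sums smM Y YM a b c p q r K =
     ((\<Sum>i<K. smM ((of_int p :: complex) gchoose i) (YM (Y a (r + int i) b) (p + q - int i) c)),
      (\<Sum>i<K. smM ((-1) ^ i * ((of_int r :: complex) gchoose i))
                 (YM a (p + r - int i) (YM b (q + int i) c)
                  - smM ((-1::complex) powi r) (YM b (q + r - int i) (YM a (p + int i) c)))))"

definition borcherds_identity ::
  "(complex \<Rightarrow> 'm::ab_group_add \<Rightarrow> 'm) \<Rightarrow> ('v \<Rightarrow> int \<Rightarrow> 'v \<Rightarrow> 'v) \<Rightarrow> ('v \<Rightarrow> int \<Rightarrow> 'm \<Rightarrow> 'm)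
     \<Rightarrow> 'v \<Rightarrow> 'v \<Rightarrow> 'm \<Rightarrow> int \<Rightarrow> int \<Rightarrow> int \<Rightarrow> bool" where
  "borcherds_identity smM Y YM a b c p q r \<longleftrightarrow>
     (\<exists>N. \<forall>K\<ge>N. fst (borcherds_sums smM Y YM a b c p q r K) = snd (borcherds_sums smM Y YM a b c p q r K))"

definition voa ::
  "(complex \<Rightarrow> 'v::ab_group_add \<Rightarrow> 'v) \<Rightarrow> ('v \<Rightarrow> int \<Rightarrow> 'v \<Rightarrow> 'v) \<Rightarrow> 'v \<Rightarrow> 'v \<Rightarrow> bool" where
  "voa sm Y vac nu \<longleftrightarrow>
     vector_space sm
   \<and> (\<forall>a n. Vector_Spaces.linear sm sm (Y a n))
   \<and> (\<forall>b n. Vector_Spaces.linear sm sm (\<lambda>a. Y a n b))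
   \<and> (\<forall>a b. \<exists>N. \<forall>n\<ge>N. Y a n b = 0)
   \<and> (\<forall>n b. Y vac n b = (if n = -1 then b else 0))
   \<and> (\<forall>a. Y a (-1) vac = a)
   \<and> (\<forall>a n. n \<ge> 0 \<longrightarrow> Y a n vac = 0)
   \<and> (\<forall>a b c p q r. borcherds_identity sm Y Y a b c p q r)
   \<and> (\<exists>cc::complex. \<forall>m n b.
        Lop Y nu m (Lop Y nu n b) - Lop Y nu n (Lop Y nu m b)
          = sm (of_int (m - n)) (Lop Y nu (m + n) b)
            + (if m + n = 0 then sm (cc / 12 * of_int (m ^ 3 - m)) b else 0))
   \<and> (\<forall>a n b. Y (Lop Y nu (-1) a) n b = sm (- of_int n) (Y a (n - 1) b))
   \<and> (\<forall>a. \<exists>f. graded_decomp sm Y nu f a)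
   \<and> (\<forall>n. \<exists>B. finite B \<and> grade sm Y nu n \<subseteq> module.span sm B)
   \<and> (\<exists>N. \<forall>n<N. grade sm Y nu n = {0})"

definition cft_type ::
  "(complex \<Rightarrow> 'v::ab_group_add \<Rightarrow> 'v) \<Rightarrow> ('v \<Rightarrow> int \<Rightarrow> 'v \<Rightarrow> 'v) \<Rightarrow> 'v \<Rightarrow> 'v \<Rightarrow> bool" where
  "cft_type sm Y vac nu \<longleftrightarrow> (\<forall>n<0. grade sm Y nu n = {0}) \<and> grade sm Y nu 0 = module.span sm {vac}"

definition simple_va ::
  "(complex \<Rightarrow> 'v::ab_group_add \<Rightarrow> 'v) \<Rightarrow> ('v \<Rightarrow> int \<Rightarrow> 'v \<Rightarrow> 'v) \<Rightarrow> bool" where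
  "simple_va sm Y \<longleftrightarrow> (\<forall>I. module.subspace sm I \<and> (\<forall>a n. \<forall>b\<in>I. Y a n b \<in> I)
       \<longrightarrow> I = {0} \<or> I = UNIV)"

text \<open>The modes a_m of the paper, defined by Y(z^{L_0} a, z) = sum_m a_m z^{-m}:
  for a homogeneous of weight d, a_m = a_(m+d-1); extended linearly.\<close>
definition pmode ::
  "(complex \<Rightarrow> 'v::ab_group_add \<Rightarrow> 'v) \<Rightarrow> ('v \<Rightarrow> int \<Rightarrow> 'v \<Rightarrow> 'v) \<Rightarrow> 'v \<Rightarrow> 'v \<Rightarrow> int \<Rightarrow> 'v \<Rightarrow> 'v" where
  "pmode sm Y nu a m b =
     (let f = (SOME f. graded_decomp sm Y nu f a) in (\<Sum>d\<in>{d. f d \<noteq> 0}. Y (f d) (m + d - 1) b))"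

definition unitary_structure ::
  "(complex \<Rightarrow> 'v::ab_group_add \<Rightarrow> 'v) \<Rightarrow> ('v \<Rightarrow> int \<Rightarrow> 'v \<Rightarrow> 'v) \<Rightarrow> 'v \<Rightarrow> 'v
     \<Rightarrow> ('v \<Rightarrow> 'v \<Rightarrow> complex) \<Rightarrow> ('v \<Rightarrow> 'v) \<Rightarrow> bool" where
  "unitary_structure sm Y vac nu ip star \<longleftrightarrow>
     (\<forall>a b c. ip (a + b) c = ip a c + ip b c)
   \<and> (\<forall>k a c. ip (sm k a) c = k * ip a c)
   \<and> (\<forall>a b. ip a b = cnj (ip b a))
   \<and> (\<forall>a. a \<noteq> 0 \<longrightarrow> Re (ip a a) > 0)
   \<and> ip vac vac = 1
   \<and> (\<forall>a b. star (a + b) = star a + star b)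
   \<and> (\<forall>k a. star (sm k a) = sm (cnj k) (star a))
   \<and> (\<forall>a. star (star a) = a)
   \<and> star nu = nu
   \<and> (\<forall>a b c n. ip b (pmode sm Y nu a n c) = ip (pmode sm Y nu (star a) (- n) b) c)"

definition simple_unitary_voa ::
  "(complex \<Rightarrow> 'v::ab_group_add \<Rightarrow> 'v) \<Rightarrow> ('v \<Rightarrow> int \<Rightarrow> 'v \<Rightarrow> 'v) \<Rightarrow> 'v \<Rightarrow> 'v
     \<Rightarrow> ('v \<Rightarrow> 'v \<Rightarrow> complex) \<Rightarrow> ('v \<Rightarrow> 'v) \<Rightarrow> bool" where
  "simple_unitary_voa sm Y vac nu ip star \<longleftrightarrow>
     voa sm Y vac nu \<and> cft_type sm Y vac nu \<and> simple_va sm Y \<and> unitary_structure sm Y vac nu ip star"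

definition vnorm :: "('v \<Rightarrow> 'v \<Rightarrow> complex) \<Rightarrow> 'v \<Rightarrow> real" where
  "vnorm ip a = sqrt (Re (ip a a))"

definition Vle ::
  "(complex \<Rightarrow> 'v::ab_group_add \<Rightarrow> 'v) \<Rightarrow> ('v \<Rightarrow> int \<Rightarrow> 'v \<Rightarrow> 'v) \<Rightarrow> 'v \<Rightarrow> int \<Rightarrow> 'v set" where
  "Vle sm Y nu n = module.span sm (\<Union>k\<in>{k. k \<le> n}. grade sm Y nu k)"

definition opnorm_n ::
  "(complex \<Rightarrow> 'v::ab_group_add \<Rightarrow> 'v) \<Rightarrow> ('v \<Rightarrow> int \<Rightarrow> 'v \<Rightarrow> 'v) \<Rightarrow> 'v \<Rightarrow> ('v \<Rightarrow> 'v \<Rightarrow> complex)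
     \<Rightarrow> ('v \<Rightarrow> 'v) \<Rightarrow> int \<Rightarrow> ennreal" where
  "opnorm_n sm Y nu ip R n =
     Sup {ennreal (vnorm ip (R b)) | b. b \<in> Vle sm Y nu n \<and> vnorm ip b \<le> 1}"

definition energy_bounds ::
  "(complex \<Rightarrow> 'v::ab_group_add \<Rightarrow> 'v) \<Rightarrow> ('v \<Rightarrow> int \<Rightarrow> 'v \<Rightarrow> 'v) \<Rightarrow> 'v \<Rightarrow> ('v \<Rightarrow> 'v \<Rightarrow> complex)
     \<Rightarrow> 'v \<Rightarrow> bool" where
  "energy_bounds sm Y nu ip a \<longleftrightarrow>
     (\<exists>s C t::real. s \<ge> 0 \<and> C \<ge> 0 \<and> t \<ge> 0 \<and>
        (\<forall>m n::int. opnorm_n sm Y nu ip (pmode sm Y nu a m) n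
            \<le> ennreal (C * (1 + real_of_int \<bar>m\<bar>) powr t * (1 + real_of_int \<bar>n\<bar>) powr s)))"

definition energy_bounded_voa ::
  "(complex \<Rightarrow> 'v::ab_group_add \<Rightarrow> 'v) \<Rightarrow> ('v \<Rightarrow> int \<Rightarrow> 'v \<Rightarrow> 'v) \<Rightarrow> 'v \<Rightarrow> ('v \<Rightarrow> 'v \<Rightarrow> complex) \<Rightarrow> bool" where
  "energy_bounded_voa sm Y nu ip \<longleftrightarrow> (\<forall>a. energy_bounds sm Y nu ip a)"

definition unitary_subalgebra ::
  "(complex \<Rightarrow> 'v::ab_group_add \<Rightarrow> 'v) \<Rightarrow> ('v \<Rightarrow> int \<Rightarrow> 'v \<Rightarrow> 'v) \<Rightarrow> 'v \<Rightarrow> 'v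
     \<Rightarrow> ('v \<Rightarrow> 'v) \<Rightarrow> 'v set \<Rightarrow> bool" where
  "unitary_subalgebra sm Y vac nu star U \<longleftrightarrow>
     module.subspace sm U \<and> vac \<in> U \<and> (\<forall>a\<in>U. \<forall>b\<in>U. \<forall>n. Y a n b \<in> U)
   \<and> Lop Y nu 0 ` U \<subseteq> U \<and> star ` U = U"

definition energy_bounded_subalgebra ::
  "(complex \<Rightarrow> 'v::ab_group_add \<Rightarrow> 'v) \<Rightarrow> ('v \<Rightarrow> int \<Rightarrow> 'v \<Rightarrow> 'v) \<Rightarrow> 'v \<Rightarrow> 'v
     \<Rightarrow> ('v \<Rightarrow> 'v \<Rightarrow> complex) \<Rightarrow> ('v \<Rightarrow> 'v) \<Rightarrow> 'v set \<Rightarrow> bool" where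
  "energy_bounded_subalgebra sm Y vac nu ip star U \<longleftrightarrow>
     unitary_subalgebra sm Y vac nu star U \<and> (\<forall>a\<in>U. energy_bounds sm Y nu ip a)"

definition msm :: "complex \<Rightarrow> (nat \<Rightarrow> complex) \<Rightarrow> (nat \<Rightarrow> complex)" where
  "msm k w = (\<lambda>i. k * w i)"

type_synonym 'v mact = "'v \<Rightarrow> int \<Rightarrow> (nat \<Rightarrow> complex) \<Rightarrow> (nat \<Rightarrow> complex)"

definition weak_module ::
  "(complex \<Rightarrow> 'v::ab_group_add \<Rightarrow> 'v) \<Rightarrow> ('v \<Rightarrow> int \<Rightarrow> 'v \<Rightarrow> 'v) \<Rightarrow> 'v \<Rightarrow> 'v set
     \<Rightarrow> (nat \<Rightarrow> complex) set \<Rightarrow> 'v mact \<Rightarrow> bool" where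
  "weak_module sm Y vac U M YM \<longleftrightarrow>
     module.subspace msm M
   \<and> (\<forall>a\<in>U. \<forall>n. \<forall>w\<in>M. YM a n w \<in> M)
   \<and> (\<forall>a\<in>U. \<forall>n. \<forall>w1\<in>M. \<forall>w2\<in>M. YM a n (w1 + w2) = YM a n w1 + YM a n w2)
   \<and> (\<forall>a\<in>U. \<forall>n k. \<forall>w\<in>M. YM a n (msm k w) = msm k (YM a n w))
   \<and> (\<forall>a1\<in>U. \<forall>a2\<in>U. \<forall>n. \<forall>w\<in>M. YM (a1 + a2) n w = YM a1 n w + YM a2 n w)
   \<and> (\<forall>a\<in>U. \<forall>n k. \<forall>w\<in>M. YM (sm k a) n w = msm k (YM a n w))
   \<and> (\<forall>a\<in>U. \<forall>w\<in>M. \<exists>N. \<forall>n\<ge>N. YM a n w = 0)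
   \<and> (\<forall>n. \<forall>w\<in>M. YM vac n w = (if n = -1 then w else 0))
   \<and> (\<forall>a\<in>U. \<forall>b\<in>U. \<forall>w\<in>M. \<forall>p q r. borcherds_identity msm Y YM a b w p q r)"

definition submodule ::
  "'v set \<Rightarrow> (nat \<Rightarrow> complex) set \<Rightarrow> 'v mact \<Rightarrow> (nat \<Rightarrow> complex) set \<Rightarrow> bool" where
  "submodule U M YM N \<longleftrightarrow> module.subspace msm N \<and> N \<subseteq> M \<and> (\<forall>a\<in>U. \<forall>n. \<forall>w\<in>N. YM a n w \<in> N)"

definition irreducible_module ::
  "(complex \<Rightarrow> 'v::ab_group_add \<Rightarrow> 'v) \<Rightarrow> ('v \<Rightarrow> int \<Rightarrow> 'v \<Rightarrow> 'v) \<Rightarrow> 'v \<Rightarrow> 'v set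
     \<Rightarrow> (nat \<Rightarrow> complex) set \<Rightarrow> 'v mact \<Rightarrow> bool" where
  "irreducible_module sm Y vac U M YM \<longleftrightarrow>
     weak_module sm Y vac U M YM \<and> M \<noteq> {0}
   \<and> (\<forall>N. submodule U M YM N \<longrightarrow> N = {0} \<or> N = M)"

definition ordinary_module ::
  "(complex \<Rightarrow> 'v::ab_group_add \<Rightarrow> 'v) \<Rightarrow> ('v \<Rightarrow> int \<Rightarrow> 'v \<Rightarrow> 'v) \<Rightarrow> 'v \<Rightarrow> 'v \<Rightarrow> 'v set
     \<Rightarrow> (nat \<Rightarrow> complex) set \<Rightarrow> 'v mact \<Rightarrow> bool" where
  "ordinary_module sm Y vac nu U M YM \<longleftrightarrow>
     weak_module sm Y vac U M YM
   \<and> (\<forall>w\<in>M. \<exists>f :: complex \<Rightarrow> (nat \<Rightarrow> complex). finite {l. f l \<noteq> 0}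
          \<and> (\<forall>l. f l \<in> M \<and> YM nu 1 (f l) = msm l (f l)) \<and> w = sum f {l. f l \<noteq> 0})
   \<and> (\<forall>l. \<exists>B. finite B \<and> {w\<in>M. YM nu 1 w = msm l w} \<subseteq> module.span msm B)
   \<and> (\<forall>l. \<exists>N::int. \<forall>n<N. {w\<in>M. YM nu 1 w = msm (l + of_int n) w} = {0})"

definition direct_sum_irreducible_ordinary ::
  "(complex \<Rightarrow> 'v::ab_group_add \<Rightarrow> 'v) \<Rightarrow> ('v \<Rightarrow> int \<Rightarrow> 'v \<Rightarrow> 'v) \<Rightarrow> 'v \<Rightarrow> 'v \<Rightarrow> 'v set
     \<Rightarrow> (nat \<Rightarrow> complex) set \<Rightarrow> 'v mact \<Rightarrow> bool" where
  "direct_sum_irreducible_ordinary sm Y vac nu U M YM \<longleftrightarrow>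
     (\<exists>Ms. (\<forall>N\<in>Ms. submodule U M YM N \<and> irreducible_module sm Y vac U N YM
                   \<and> ordinary_module sm Y vac nu U N YM)
         \<and> module.span msm (\<Union>Ms) = M
         \<and> (\<forall>N\<in>Ms. N \<inter> module.span msm (\<Union>(Ms - {N})) = {0}))"

definition regular_voa ::
  "(complex \<Rightarrow> 'v::ab_group_add \<Rightarrow> 'v) \<Rightarrow> ('v \<Rightarrow> int \<Rightarrow> 'v \<Rightarrow> 'v) \<Rightarrow> 'v \<Rightarrow> 'v \<Rightarrow> 'v set \<Rightarrow> bool" where
  "regular_voa sm Y vac nu U \<longleftrightarrow>
     (\<forall>M YM. weak_module sm Y vac U M YM \<longrightarrow> direct_sum_irreducible_ordinary sm Y vac nu U M YM)"

end

(*
  In the Borcherds identity with r = -1 all coefficients on the operator side equal 1,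
  so pairing it with b shows that |a_k b|^2 + |a*_{1-k} b|^2 is bounded by finitely many expectations
  (b | x_0 b) with coefficients polynomial in k, where x = c_(i) a and c is a homogeneous component of a*
  (which need not be homogeneous). If V is spanned by vectors u_(n) a with u in U and a
  in a finite set A, then the identity for (u_(n) a)_0, with the left factor of every product moved to
  the other side of the scalar product, bounds each expectation by poly(N) S for b in V_{<=N}, |b| <= 1,
  where S is the maximum of |a_k b| and |a*_k b| over a in A and k >= -K. Hence S^2 <= poly(N) S, so
  S <= poly(N), and feeding this back bounds all modes of all vectors.

  Regularity yields the finite set A. If there were nonzero lowest weight vectors w_h for U in
  infinitely many weights h, the formal sum of the w_h would lie in a weak module contained in the
  algebraic completion of V, realised as antilinear functionals on V. By regularity it would be a
  finite sum of L_0-eigenvectors, which is absurd. So lowest weight vectors occur only up to some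
  weight H, and by unitarity the spaces V_h with h <= H generate V under U.
*)
theory Submission
  imports Defs
begin

text \<open>The gain from S^2 to S rests on an asymmetry: each product in the expansion of (u_(n)
  a)_0 contains one mode of U, polynomially bounded by hypothesis, and only one mode of a. S is
  finite before any estimate is made, because modes of index above N kill b and only the indices
  from -K to N count. The cutoff -K is harmless: the products paired with b involve no index below
  it, and the remaining modes are bounded at the very end. Regularity speaks of modules carried by
  subspaces of nat => complex, whereas the completion is the product of all weight spaces. Its
  vectors are determined by their pairings with a countable spanning family of V, which gives the
  encoding. The scalar product is linear in its first argument, so w becomes the antilinear
  functional v -> (w|v). The obstacle there is the Borcherds identity: on V the partial sums agree
  from a threshold that depends on the vector, while an element of the completion is tested against
  all of V at once and needs one common threshold.\<close>

section \<open>Growth of generalized binomial coefficients\<close>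

lemma gbinomial_Suc_eq:
  fixes a :: complex
  shows "a gchoose Suc k = (a - of_nat k) / of_nat (Suc k) * (a gchoose k)"
proof -
  have "of_nat (Suc k) * (a gchoose Suc k) = (a - of_nat k) * (a gchoose k)"
    using gbinomial_mult_1[of a k] by (simp add: algebra_simps)
  moreover have "of_nat (Suc k) \<noteq> (0 :: complex)" by (rule of_nat_neq_0)
  ultimately show ?thesis by (simp add: divide_simps mult.commute del: of_nat_Suc)
qed

lemma norm_gbinomial_Suc_le:
  "norm (of_int z gchoose Suc k :: complex)
     \<le> (real_of_int \<bar>z\<bar> + real k) / real (Suc k) * norm (of_int z gchoose k :: complex)"
proof -
  have "norm (of_int z - of_nat k :: complex) \<le> real_of_int \<bar>z\<bar> + real k"
    using norm_triangle_ineq4[of "of_int z :: complex" "of_nat k"] by simp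
  then have "norm (of_int z - of_nat k :: complex) / real (Suc k) \<le> (real_of_int \<bar>z\<bar> + real k) / real (Suc k)"
    by (rule divide_right_mono) simp
  then show ?thesis
    unfolding gbinomial_Suc_eq norm_mult norm_divide norm_of_nat
    by (rule mult_right_mono) simp
qed

text \<open>For bounded \<open>i\<close> this is polynomial in \<open>z\<close>; it is applied to
  \<open>z = e - k\<close> with varying mode index \<open>k\<close>. Each ratio of consecutive
  coefficients is at most (|z| + j) / (j + 1) \<le> 1 + |z|.\<close>

lemma norm_gbinomial_le_power_top:
  "norm (of_int z gchoose i :: complex) \<le> (1 + real_of_int \<bar>z\<bar>) ^ i"
proof (induction i)
  case (Suc i)
  have "real_of_int \<bar>z\<bar> \<le> real_of_int \<bar>z\<bar> * (1 + real i)"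
    by (simp add: algebra_simps)
  then have "(real_of_int \<bar>z\<bar> + real i) / real (Suc i) \<le> 1 + real_of_int \<bar>z\<bar>"
    by (simp add: divide_simps algebra_simps)
  then have "(real_of_int \<bar>z\<bar> + real i) / real (Suc i) * norm (of_int z gchoose i :: complex)
      \<le> (1 + real_of_int \<bar>z\<bar>) * (1 + real_of_int \<bar>z\<bar>) ^ i"
    using Suc by (intro mult_mono) auto
  then show ?case using norm_gbinomial_Suc_le[of z i] by simp
qed simp

text \<open>The regime opposite to the previous one: in the expansion of u_(n) a the top
  \<open>z = n\<close> is fixed, while \<open>i\<close> grows with the energy level. The bound
  telescopes, the factor at stage \<open>i\<close> being ((i + 2) / (i + 1)) ^ |z|.\<close>

lemma norm_gbinomial_le_power_bottom:
  "norm (of_int z gchoose i :: complex) \<le> (1 + real i) ^ nat \<bar>z\<bar>"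
proof (induction i)
  case (Suc i)
  define m where "m = nat \<bar>z\<bar>"
  have m: "real_of_int \<bar>z\<bar> = real m" by (simp add: m_def)
  have "(real m + real i) / real (Suc i) \<le> 1 + real m * (1 / real (Suc i))"
    by (simp add: divide_simps)
  \<comment> \<open>Bernoulli turns the ratio of consecutive coefficients into the power that
    telescopes.\<close>
  also have "\<dots> \<le> (1 + 1 / real (Suc i)) ^ m"
    by (rule Bernoulli_inequality) (simp add: divide_simps)
  finally have "(real m + real i) / real (Suc i) * norm (of_int z gchoose i :: complex)
      \<le> (1 + 1 / real (Suc i)) ^ m * (1 + real i) ^ m"
    using Suc by (intro mult_mono) (auto simp: m_def)
  also have "\<dots> = (1 + real (Suc i)) ^ m"
    by (simp add: divide_simps flip: power_mult_distrib)
  finally show ?case using norm_gbinomial_Suc_le[of z i] m by (simp add: m_def)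
qed simp

lemma vector_space_msm: "vector_space msm"
  by unfold_locales (auto simp: msm_def fun_eq_iff algebra_simps)

interpretation msm: vector_space msm
  by (rule vector_space_msm)

lemma sum_fun_apply': "(\<Sum>i\<in>S. f i) x = (\<Sum>i\<in>S. f i x)" for f :: "'i \<Rightarrow> 'a \<Rightarrow> complex"
  by (induction S rule: infinite_finite_induct) auto

section \<open>Vertex operator algebras of CFT type with a unitary structure\<close>

locale unitary_voa =
  fixes sm :: "complex \<Rightarrow> 'v::ab_group_add \<Rightarrow> 'v"
    and Y :: "'v \<Rightarrow> int \<Rightarrow> 'v \<Rightarrow> 'v"
    and vac nu :: 'v
    and ip :: "'v \<Rightarrow> 'v \<Rightarrow> complex"
    and star :: "'v \<Rightarrow> 'v"
  assumes is_voa: "voa sm Y vac nu"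
    and is_cft_type: "cft_type sm Y vac nu"
    and is_unitary: "unitary_structure sm Y vac nu ip star"
begin

sublocale vector_space sm
  using is_voa by (simp add: voa_def)

abbreviation V :: "int \<Rightarrow> 'v set" where "V \<equiv> grade sm Y nu"
abbreviation VL :: "int \<Rightarrow> 'v set" where "VL \<equiv> Vle sm Y nu"
abbreviation md :: "'v \<Rightarrow> int \<Rightarrow> 'v \<Rightarrow> 'v" where "md \<equiv> pmode sm Y nu"
abbreviation nrm :: "'v \<Rightarrow> real" where "nrm \<equiv> vnorm ip"

lemma linear_Y_right: "Vector_Spaces.linear sm sm (Y a n)"
  using is_voa by (simp add: voa_def)

lemma linear_Y_left: "Vector_Spaces.linear sm sm (\<lambda>a. Y a n b)"
  using is_voa by (simp add: voa_def)

lemma Y_add_right: "Y a n (b + c) = Y a n b + Y a n c"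
  and Y_scale_right: "Y a n (sm k b) = sm k (Y a n b)"
  using linear_Y_right[of a n] by (simp_all add: Vector_Spaces.linear_iff)

lemma Y_add_left: "Y (a + b) n c = Y a n c + Y b n c"
  and Y_scale_left: "Y (sm k a) n c = sm k (Y a n c)"
  using linear_Y_left[of n c] by (simp_all add: Vector_Spaces.linear_iff)

lemma Y_zero_right [simp]: "Y a n 0 = 0"
  using Y_scale_right[of a n 0 0] by simp

lemma Y_zero_left [simp]: "Y 0 n a = 0"
  using Y_scale_left[of 0 0 n a] by simp

lemma Y_sum_right: "Y a n (sum f S) = (\<Sum>x\<in>S. Y a n (f x))"
  by (induction S rule: infinite_finite_induct) (auto simp: Y_add_right)

lemma Y_sum_left: "Y (sum f S) n a = (\<Sum>x\<in>S. Y (f x) n a)"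
  by (induction S rule: infinite_finite_induct) (auto simp: Y_add_left)

lemma Y_truncated: "\<exists>N. \<forall>n\<ge>N. Y a n b = 0"
  using is_voa by (simp add: voa_def)

lemma Y_vac_left: "Y vac n b = (if n = -1 then b else 0)"
  using is_voa by (simp add: voa_def)

lemma Y_vac_right: "Y a (-1) vac = a" "n \<ge> 0 \<Longrightarrow> Y a n vac = 0"
  using is_voa by (simp_all add: voa_def)

lemma borcherds: "borcherds_identity sm Y Y a b c p q r"
  using is_voa by (simp add: voa_def)

lemma Virasoro:
  "\<exists>cc::complex. \<forall>m n b. Lop Y nu m (Lop Y nu n b) - Lop Y nu n (Lop Y nu m b)
          = sm (of_int (m - n)) (Lop Y nu (m + n) b)
            + (if m + n = 0 then sm (cc / 12 * of_int (m ^ 3 - m)) b else 0)"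
  using is_voa by (simp add: voa_def)

lemma Y_L_minus1: "Y (Y nu 0 a) n b = sm (- of_int n) (Y a (n - 1) b)"
  using is_voa by (simp add: voa_def Lop_def)

lemma ex_graded_decomp: "\<exists>f. graded_decomp sm Y nu f a"
  using is_voa by (simp add: voa_def)

lemma ex_finite_span_grade: "\<exists>B. finite B \<and> V n \<subseteq> span B"
  using is_voa by (simp add: voa_def)

lemma grade_neg: "n < 0 \<Longrightarrow> V n = {0}"
  using is_cft_type by (simp add: cft_type_def)

lemma mem_grade: "a \<in> V n \<longleftrightarrow> Y nu 1 a = sm (of_int n) a"
  by (simp add: grade_def Lop_def)

lemma subspace_grade: "subspace (V n)"
  by (auto simp: subspace_def mem_grade Y_add_right Y_scale_right scale_right_distrib scale_left_commute)

subsection \<open>Graded components\<close>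

text \<open>Applying L_0 - e removes the component of weight \<open>e\<close> and multiplies the
  others by d - e, which is nonzero; this allows induction on the number of weights.\<close>

lemma grade_independent:
  assumes "finite S" "\<And>d. d \<in> S \<Longrightarrow> f d \<in> V d" "sum f S = 0" "d \<in> S"
  shows "f d = 0"
  using assms
proof (induction S arbitrary: f d rule: finite_induct)
  case (insert e S)
  have 1: "(\<Sum>d\<in>S. sm (of_int (d - e)) (f d)) = 0"
  proof -
    have "Y nu 1 (sum f (insert e S)) - sm (of_int e) (sum f (insert e S)) = 0"
      using insert.prems by simp
    also have "Y nu 1 (sum f (insert e S)) = (\<Sum>d\<in>insert e S. sm (of_int d) (f d))"
      unfolding Y_sum_right using insert.prems(1) by (intro sum.cong) (auto simp: mem_grade)
    finally have "(\<Sum>d\<in>insert e S. sm (of_int d) (f d) - sm (of_int e) (f d)) = 0"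
      by (simp only: scale_sum_right sum_subtractf)
    then show ?thesis
      using insert.hyps by (simp flip: scale_left_diff_distrib)
  qed
  have 2: "f d = 0" if "d \<in> S" for d
  proof -
    have "sm (of_int (d - e)) (f d) = 0"
      using insert.IH[of "\<lambda>d. sm (of_int (d - e)) (f d)" d] 1 that insert.prems(1)
      by (auto simp: subspace_grade subspace_scale)
    moreover have "d \<noteq> e" using that insert.hyps by auto
    ultimately show ?thesis by simp
  qed
  moreover have "f e = 0"
    using insert.prems(2) insert.hyps 2 by simp
  ultimately show ?case using insert.prems by auto
qed auto

text \<open>The same choice as inside \<open>pmode\<close>. By \<open>dec_unique\<close> every
  decomposition yields these components, so the choice is immaterial.\<close>

definition dec :: "'v \<Rightarrow> int \<Rightarrow> 'v" where
  "dec a = (SOME f. graded_decomp sm Y nu f a)"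

lemma graded_decomp_dec: "graded_decomp sm Y nu (dec a) a"
  unfolding dec_def using ex_graded_decomp by (rule someI_ex)

lemma finite_dec: "finite {d. dec a d \<noteq> 0}"
  and dec_grade: "dec a d \<in> V d"
  and dec_sum: "a = sum (dec a) {d. dec a d \<noteq> 0}"
  using graded_decomp_dec[of a] by (auto simp: graded_decomp_def)

lemma dec_sum_superset: "finite S \<Longrightarrow> {d. dec a d \<noteq> 0} \<subseteq> S \<Longrightarrow> sum (dec a) S = a"
  by (subst dec_sum[of a], rule sum.mono_neutral_right) auto

lemma dec_unique:
  assumes S: "finite S" and f: "\<And>d. d \<in> S \<Longrightarrow> f d \<in> V d" and "a = sum f S"
  shows "dec a d = (if d \<in> S then f d else 0)"
proof -
  define T where "T = S \<union> {d. dec a d \<noteq> 0} \<union> {d}"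
  define g where "g e = dec a e - (if e \<in> S then f e else 0)" for e
  have T: "finite T" using S finite_dec by (simp add: T_def)
  have "sum (\<lambda>e. if e \<in> S then f e else 0) T = sum f S"
    using T by (intro sum.mono_neutral_cong_right) (auto simp: T_def)
  moreover have "sum (dec a) T = a"
    using T by (rule dec_sum_superset) (auto simp: T_def)
  ultimately have "sum g T = 0"
    unfolding g_def using assms(3) by (simp add: sum_subtractf)
  then have "g d = 0"
    using grade_independent[OF T, of g d]
    by (auto simp: g_def T_def f dec_grade subspace_grade subspace_diff subspace_0)
  then show ?thesis by (simp add: g_def)
qed

lemma dec_homogeneous: "a \<in> V d \<Longrightarrow> dec a e = (if e = d then a else 0)"
  using dec_unique[of "{d}" "\<lambda>_. a" a e] by auto

lemma dec_add: "dec (a + b) d = dec a d + dec b d"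
proof -
  define T where "T = {d. dec a d \<noteq> 0} \<union> {d. dec b d \<noteq> 0} \<union> {d}"
  have T: "finite T" by (simp add: T_def finite_dec)
  have "sum (dec a) T = a" "sum (dec b) T = b"
    by (rule dec_sum_superset[OF T], force simp: T_def)+
  then have "dec (a + b) d = (if d \<in> T then dec a d + dec b d else 0)"
    using T by (intro dec_unique) (auto simp: dec_grade subspace_grade subspace_add sum.distrib)
  then show ?thesis by (simp add: T_def)
qed

lemma dec_scale: "dec (sm k a) d = sm k (dec a d)"
proof -
  define T where "T = {d. dec a d \<noteq> 0} \<union> {d}"
  have T: "finite T" by (simp add: T_def finite_dec)
  have "sum (dec a) T = a"
    by (rule dec_sum_superset[OF T]) (force simp: T_def)
  then have "dec (sm k a) d = (if d \<in> T then sm k (dec a d) else 0)"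
    using T by (intro dec_unique) (auto simp: dec_grade subspace_grade subspace_scale simp flip: scale_sum_right)
  then show ?thesis by (simp add: T_def)
qed

lemma dec_nonneg: "dec a d \<noteq> 0 \<Longrightarrow> d \<ge> 0"
  using dec_grade[of a d] grade_neg[of d] by (cases "d < 0") auto

lemma ex_dec_bound: "\<exists>D. \<forall>d. dec a d \<noteq> 0 \<longrightarrow> d \<le> D"
  using finite_dec[of a] bdd_above_finite[of "{d. dec a d \<noteq> 0}"] by (auto simp: bdd_above_def)

text \<open>Lagrange interpolation in L0, in inductive form.\<close>
lemma sum_grade_in_subspace:
  assumes "finite S" "\<And>d. d \<in> S \<Longrightarrow> f d \<in> V d" "sum f S \<in> W" "d \<in> S"
    and W: "subspace W" "\<And>x. x \<in> W \<Longrightarrow> Y nu 1 x \<in> W"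
  shows "f d \<in> W"
  using assms(1-4)
proof (induction S arbitrary: f d rule: finite_induct)
  case (insert e S)
  have 1: "(\<Sum>d\<in>S. sm (of_int (d - e)) (f d)) \<in> W"
  proof -
    have "Y nu 1 (sum f (insert e S)) - sm (of_int e) (sum f (insert e S)) \<in> W"
      using insert.prems W by (simp add: subspace_diff subspace_scale)
    also have "Y nu 1 (sum f (insert e S)) = (\<Sum>d\<in>insert e S. sm (of_int d) (f d))"
      unfolding Y_sum_right using insert.prems(1) by (intro sum.cong) (auto simp: mem_grade)
    finally have "(\<Sum>d\<in>insert e S. sm (of_int d) (f d) - sm (of_int e) (f d)) \<in> W"
      by (simp only: scale_sum_right sum_subtractf)
    then show ?thesis
      using insert.hyps by (simp flip: scale_left_diff_distrib)
  qed
  have 2: "f d \<in> W" if "d \<in> S" for d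
  proof -
    have "sm (of_int (d - e)) (f d) \<in> W"
      using insert.IH[of "\<lambda>d. sm (of_int (d - e)) (f d)" d] 1 that insert.prems(1)
      by (auto simp: subspace_grade subspace_scale)
    then have "sm (1 / of_int (d - e)) (sm (of_int (d - e)) (f d)) \<in> W"
      using W by (blast intro: subspace_scale)
    moreover have "d \<noteq> e" using that insert.hyps by auto
    ultimately show ?thesis by simp
  qed
  moreover have "f e \<in> W"
  proof -
    have "f e = sum f (insert e S) - sum f S" using insert.hyps by simp
    then show ?thesis using insert.prems 2 W by (simp add: subspace_diff subspace_sum)
  qed
  ultimately show ?case using insert.prems by auto
qed auto

lemma dec_in_subspace:
  assumes "subspace W" "\<And>x. x \<in> W \<Longrightarrow> Y nu 1 x \<in> W" "a \<in> W"
  shows "dec a d \<in> W"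
proof (cases "dec a d = 0")
  case False
  show ?thesis
    by (rule sum_grade_in_subspace[of "{d. dec a d \<noteq> 0}" "dec a" W d])
      (use assms False finite_dec dec_grade dec_sum[of a] in auto)
qed (use assms in \<open>simp add: subspace_0\<close>)

subsection \<open>Modes and energy\<close>

text \<open>The Borcherds identity with p = 1, r = 0: the coefficients (1 choose i) leave i = 0, 1
  on one side, (0 choose i) leaves i = 0 on the other, and the derivative rule for L_(-1) evaluates
  the term i = 1.\<close>

lemma L0_commutator: "Y nu 1 (Y a n c) - Y a n (Y nu 1 c) = Y (Y nu 1 a) n c - sm (of_int (n + 1)) (Y a n c)"
proof -
  obtain N where N: "\<And>K. K \<ge> N \<Longrightarrow> fst (borcherds_sums sm Y Y nu a c 1 n 0 K) = snd (borcherds_sums sm Y Y nu a c 1 n 0 K)"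
    using borcherds[of nu a c 1 n 0] by (auto simp: borcherds_identity_def)
  \<comment> \<open>Beyond the threshold, and large enough to include both surviving terms i = 0 and
    i = 1.\<close>
  define K where "K = N + 2"
  have b0: "(0 gchoose i :: complex) = (if i = 0 then 1 else 0)" for i
    using gbinomial_0_left gbinomial_0 by (cases i) auto
  have b1: "(1 gchoose i :: complex) = (if i = 0 then 1 else if i = 1 then 1 else 0)" for i
    using binomial_gbinomial[of 1 i, where ?'a = complex] by (cases "i \<ge> 2") (auto simp: less_Suc_eq numeral_2_eq_2 not_le binomial_eq_0)
  have "fst (borcherds_sums sm Y Y nu a c 1 n 0 K) = (\<Sum>i\<in>{0,1::nat}. sm (1 gchoose i) (Y (Y nu (int i) a) (1 + n - int i) c))"
    unfolding borcherds_sums_def fst_conv of_int_1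
    by (intro sum.mono_neutral_cong_right) (auto simp: K_def b1)
  also have "\<dots> = Y (Y nu 1 a) n c + Y (Y nu 0 a) (1 + n) c" by (simp add: b1)
  finally have 1: "fst (borcherds_sums sm Y Y nu a c 1 n 0 K) = Y (Y nu 1 a) n c + Y (Y nu 0 a) (1 + n) c" .
  have "snd (borcherds_sums sm Y Y nu a c 1 n 0 K) = (\<Sum>i\<in>{0::nat}. sm ((-1) ^ i * (0 gchoose i))
                 (Y nu (1 - int i) (Y a (n + int i) c) - sm 1 (Y a (n - int i) (Y nu (1 + int i) c))))"
    unfolding borcherds_sums_def snd_conv of_int_0
    by (intro sum.mono_neutral_cong_right) (auto simp: K_def b0)
  also have "\<dots> = Y nu 1 (Y a n c) - Y a n (Y nu 1 c)" by simp
  finally have "Y nu 1 (Y a n c) - Y a n (Y nu 1 c) = Y (Y nu 1 a) n c + sm (- of_int (1 + n)) (Y a n c)"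
    using N[of K] 1 unfolding Y_L_minus1 K_def by simp
  then show ?thesis by (metis add.commute add_uminus_conv_diff scale_minus_left)
qed

lemma Y_grade:
  assumes "a \<in> V d" "c \<in> V h"
  shows "Y a n c \<in> V (d + h - n - 1)"
proof -
  let ?x = "Y a n c"
  have "Y nu 1 ?x = sm (of_int h) ?x + sm (of_int d) ?x - sm (of_int (n + 1)) ?x"
    using L0_commutator[of a n c] assms by (simp add: mem_grade Y_scale_left Y_scale_right diff_eq_eq)
  also have "\<dots> = sm (of_int h + of_int d - of_int (n + 1)) ?x"
    by (simp only: scale_left_diff_distrib scale_left_distrib)
  also have "of_int h + of_int d - of_int (n + 1) = (of_int (d + h - n - 1) :: complex)" by simp
  finally show ?thesis by (simp only: mem_grade)
qed

lemma pmode_eq: "md a m b = (\<Sum>d\<in>{d. dec a d \<noteq> 0}. Y (dec a d) (m + d - 1) b)"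
  by (simp add: pmode_def dec_def Let_def)

lemma pmode_superset:
  "finite S \<Longrightarrow> {d. dec a d \<noteq> 0} \<subseteq> S \<Longrightarrow> md a m b = (\<Sum>d\<in>S. Y (dec a d) (m + d - 1) b)"
  unfolding pmode_eq by (rule sum.mono_neutral_left) auto

lemma pmode_homogeneous:
  assumes "a \<in> V d"
  shows "md a m b = Y a (m + d - 1) b"
proof -
  have "md a m b = (\<Sum>e\<in>{d}. Y (dec a e) (m + e - 1) b)"
    by (rule pmode_superset) (auto simp: dec_homogeneous[OF assms])
  then show ?thesis by (simp add: dec_homogeneous[OF assms])
qed

lemma pmode_dec: "md a m b = (\<Sum>d\<in>{d. dec a d \<noteq> 0}. md (dec a d) m b)"
  unfolding pmode_eq[of a] by (intro sum.cong refl) (simp add: pmode_homogeneous[OF dec_grade])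

lemma pmode_add_left: "md (a + b) m c = md a m c + md b m c"
proof -
  let ?S = "{d. dec a d \<noteq> 0} \<union> {d. dec b d \<noteq> 0}"
  have S: "finite ?S" by (simp add: finite_dec)
  have *: "md x m c = (\<Sum>d\<in>?S. Y (dec x d) (m + d - 1) c)" if "x \<in> {a, b, a + b}" for x
    by (rule pmode_superset[OF S]) (use that in \<open>auto simp: dec_add\<close>)
  have "md (a + b) m c = (\<Sum>d\<in>?S. Y (dec a d + dec b d) (m + d - 1) c)"
    using *[of "a + b"] by (simp add: dec_add)
  also have "\<dots> = md a m c + md b m c"
    using *[of a] *[of b] by (simp add: Y_add_left sum.distrib)
  finally show ?thesis .
qed

lemma pmode_scale_left: "md (sm k a) m c = sm k (md a m c)"
proof -
  have "md (sm k a) m c = (\<Sum>d\<in>{d. dec a d \<noteq> 0}. Y (dec (sm k a) d) (m + d - 1) c)"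
    by (rule pmode_superset[OF finite_dec[of a]]) (auto simp: dec_scale)
  also have "\<dots> = sm k (md a m c)"
    by (simp add: pmode_eq[of a] scale_sum_right[of k] dec_scale Y_scale_left)
  finally show ?thesis .
qed

lemma pmode_zero_left [simp]: "md 0 m c = 0"
  using pmode_scale_left[of 0 0 m c] by simp

lemma pmode_add_right: "md a m (b + c) = md a m b + md a m c"
  by (simp add: pmode_eq Y_add_right sum.distrib)

lemma pmode_zero_right [simp]: "md a m 0 = 0"
  by (simp add: pmode_eq)

lemma pmode_grade: "c \<in> V h \<Longrightarrow> md a m c \<in> V (h - m)"
  unfolding pmode_eq
proof (rule subspace_sum[OF subspace_grade])
  fix d assume "c \<in> V h"
  then show "Y (dec a d) (m + d - 1) c \<in> V (h - m)"
    using Y_grade[OF dec_grade[of a d], of c h "m + d - 1"] by simp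
qed

lemma subspace_Vle: "subspace (VL n)"
  by (simp add: Vle_def)

lemma grade_subset_Vle: "k \<le> n \<Longrightarrow> V k \<subseteq> VL n"
  unfolding Vle_def by (auto intro!: span_base)

lemma Vle_mono: "m \<le> n \<Longrightarrow> VL m \<subseteq> VL n"
  unfolding Vle_def by (intro span_mono UN_mono) auto

lemma Vle_neg: "n < 0 \<Longrightarrow> VL n = {0}"
proof -
  assume "n < 0"
  then have "(\<Union>k\<in>{k. k \<le> n}. V k) = {0}" by (auto simp: grade_neg subspace_0 subspace_grade)
  then show ?thesis by (simp add: Vle_def)
qed

lemma Vle_eq: "n \<ge> 0 \<Longrightarrow> VL n = span (\<Union>k\<in>{0..n}. V k)"
proof -
  assume "n \<ge> 0"
  have "(\<Union>k\<in>{k. k \<le> n}. V k) = (\<Union>k\<in>{0..n}. V k)"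
  proof safe
    fix x k assume "x \<in> V k" "k \<le> n"
    then show "x \<in> (\<Union>k\<in>{0..n}. V k)"
      using \<open>n \<ge> 0\<close> grade_neg[of k] subspace_0[OF subspace_grade[of 0]]
      by (cases "k < 0") auto
  qed auto
  then show ?thesis by (simp add: Vle_def)
qed

lemma Vle_induct [consumes 1, case_names grade zero add]:
  assumes "b \<in> VL n" and "\<And>k x. k \<le> n \<Longrightarrow> x \<in> V k \<Longrightarrow> P x"
    and "P 0" "\<And>x y. P x \<Longrightarrow> P y \<Longrightarrow> P (x + y)"
  shows "P b"
  using assms(1) unfolding Vle_def
proof (induction rule: span_induct_alt)
  case (step c x y)
  then obtain k where "k \<le> n" "sm c x \<in> V k"
    using subspace_scale[OF subspace_grade] by blast
  then show ?case using step assms by blast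
qed (use assms in auto)

lemma pmode_Vle: "b \<in> VL n \<Longrightarrow> md a m b \<in> VL (n - m)"
proof (induction rule: Vle_induct)
  case (grade k x)
  then show ?case using pmode_grade[of x k a m] grade_subset_Vle[of "k - m" "n - m"] by auto
qed (auto simp: pmode_add_right subspace_Vle subspace_0 subspace_add)

lemma ex_Vle: "\<exists>n\<ge>0. b \<in> VL n"
proof -
  obtain D where D: "\<And>d. dec b d \<noteq> 0 \<Longrightarrow> d \<le> D" using ex_dec_bound by blast
  have "sum (dec b) {d. dec b d \<noteq> 0} \<in> VL (max D 0)"
  proof (rule subspace_sum[OF subspace_Vle])
    fix d assume "d \<in> {d. dec b d \<noteq> 0}"
    then have "d \<le> max D 0" using D[of d] by auto
    then show "dec b d \<in> VL (max D 0)" using dec_grade grade_subset_Vle by blast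
  qed
  then show ?thesis using dec_sum[of b] by (intro exI[of _ "max D 0"]) auto
qed

lemma ex_finite_span_subspace:
  assumes "W \<subseteq> span T" "finite T"
  shows "\<exists>B. finite B \<and> B \<subseteq> W \<and> W \<subseteq> span B"
proof -
  obtain B where B: "B \<subseteq> W" "independent B" "W \<subseteq> span B"
    using maximal_independent_subset by blast
  moreover have "finite B"
    using independent_span_bound[of T B] B assms by auto
  ultimately show ?thesis by blast
qed

lemma ex_finite_span_Vle: "\<exists>B. finite B \<and> B \<subseteq> VL n \<and> VL n \<subseteq> span B"
proof (cases "n < 0")
  case True
  then show ?thesis by (intro exI[of _ "{}"]) (simp add: Vle_neg)
next
  case False
  obtain F where F: "\<And>k. finite (F k) \<and> V k \<subseteq> span (F k)" using ex_finite_span_grade by metis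
  let ?T = "\<Union>k\<in>{0..n}. F k"
  have "V k \<subseteq> span ?T" if "k \<in> {0..n}" for k
    using F[of k] span_mono[of "F k" ?T] that by blast
  then have *: "VL n \<subseteq> span ?T" unfolding Vle_eq[OF False[unfolded not_less]]
    by (intro span_minimal UN_least subspace_span)
  show ?thesis using F by (intro ex_finite_span_subspace[OF *]) simp
qed

subsection \<open>The scalar product\<close>

lemmas unitary_facts = is_unitary[unfolded unitary_structure_def]
lemmas ip_add_left = unitary_facts[THEN conjunct1, rule_format]
lemmas ip_scale_left = unitary_facts[THEN conjunct2, THEN conjunct1, rule_format]
lemmas ip_conj = unitary_facts[THEN conjunct2, THEN conjunct2, THEN conjunct1, rule_format]
lemmas ip_pos = unitary_facts[THEN conjunct2, THEN conjunct2, THEN conjunct2, THEN conjunct1, rule_format]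
lemmas star_star [simp] = unitary_facts[THEN conjunct2, THEN conjunct2, THEN conjunct2, THEN conjunct2, THEN conjunct2, THEN conjunct2, THEN conjunct2, THEN conjunct1, rule_format]
lemmas star_nu [simp] = unitary_facts[THEN conjunct2, THEN conjunct2, THEN conjunct2, THEN conjunct2, THEN conjunct2, THEN conjunct2, THEN conjunct2, THEN conjunct2, THEN conjunct1, rule_format]
lemmas ip_pmode = unitary_facts[THEN conjunct2, THEN conjunct2, THEN conjunct2, THEN conjunct2, THEN conjunct2, THEN conjunct2, THEN conjunct2, THEN conjunct2, THEN conjunct2, rule_format]

lemma ip_add_right: "ip a (b + c) = ip a b + ip a c"
  by (metis complex_cnj_add ip_add_left ip_conj)

lemma ip_scale_right: "ip a (sm k b) = cnj k * ip a b"
  by (metis complex_cnj_mult ip_scale_left ip_conj)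

lemma ip_zero_left [simp]: "ip 0 a = 0"
  using ip_scale_left[of 0 0 a] by simp

lemma ip_zero_right [simp]: "ip a 0 = 0"
  using ip_scale_right[of a 0 0] by simp

lemma ip_diff_left: "ip (a - b) c = ip a c - ip b c"
  using ip_add_left[of "a - b" b c] by simp

lemma ip_diff_right: "ip a (b - c) = ip a b - ip a c"
  using ip_add_right[of a "b - c" c] by simp

lemma ip_sum_left: "ip (sum f S) a = (\<Sum>x\<in>S. ip (f x) a)"
  by (induction S rule: infinite_finite_induct) (auto simp: ip_add_left)

lemma ip_sum_right: "ip a (sum f S) = (\<Sum>x\<in>S. ip a (f x))"
  by (induction S rule: infinite_finite_induct) (auto simp: ip_add_right)

lemma ip_self_nonneg: "Re (ip a a) \<ge> 0"
  using ip_pos[of a] by (cases "a = 0") auto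

lemma ip_self: "ip a a = of_real ((nrm a)\<^sup>2)"
proof -
  have "Im (ip a a) = 0" using arg_cong[OF ip_conj[of a a], of Im] by simp
  then show ?thesis using ip_self_nonneg[of a] by (simp add: complex_eq_iff vnorm_def)
qed

lemma nrm_nonneg [simp]: "nrm a \<ge> 0"
  by (simp add: vnorm_def ip_self_nonneg)

lemma nrm_eq_0 [simp]: "nrm a = 0 \<longleftrightarrow> a = 0"
  using ip_pos[of a] by (cases "a = 0") (auto simp: vnorm_def)

lemma nrm_zero [simp]: "nrm 0 = 0" by simp

lemma ip_self_eq_0 [simp]: "ip a a = 0 \<longleftrightarrow> a = 0"
  by (simp add: ip_self)

lemma ip_eqI: "(\<And>c. ip a c = ip b c) \<Longrightarrow> a = b"
  using ip_self_eq_0[of "a - b"] by (simp only: ip_diff_left) simp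

lemma Cauchy_Schwarz: "norm (ip a b) \<le> nrm a * nrm b"
proof (cases "b = 0")
  case False
  define t where "t = ip a b / ip b b"
  have "0 \<le> Re (ip (a - sm t b) (a - sm t b))" by (rule ip_self_nonneg)
  also have "ip (a - sm t b) (a - sm t b) = ip a a - t * ip b a"
  proof -
    have "ip (a - sm t b) b = 0" using False by (simp add: ip_diff_left ip_scale_left t_def)
    then have "ip (a - sm t b) (a - sm t b) = ip (a - sm t b) a"
      unfolding ip_diff_right ip_scale_right by simp
    then show ?thesis by (simp only: ip_diff_left ip_scale_left)
  qed
  also have "t * ip b a = of_real ((norm (ip a b))\<^sup>2 / (nrm b)\<^sup>2)"
    unfolding ip_conj[of b a] using complex_norm_square[of "ip a b"] by (simp add: t_def ip_self)
  finally have "(norm (ip a b))\<^sup>2 \<le> (nrm a * nrm b)\<^sup>2"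
    using False by (simp add: ip_self divide_simps power_mult_distrib)
  then show ?thesis by (rule power2_le_imp_le) simp
qed simp

lemma nrm_triangle: "nrm (a + b) \<le> nrm a + nrm b"
proof -
  have "(nrm (a + b))\<^sup>2 = Re (ip (a + b) (a + b))" by (simp add: ip_self)
  also have "\<dots> = (nrm a)\<^sup>2 + (nrm b)\<^sup>2 + 2 * Re (ip a b)"
    using arg_cong[OF ip_conj[of b a], of Re] unfolding ip_add_left ip_add_right by (simp add: ip_self)
  also have "\<dots> \<le> (nrm a)\<^sup>2 + (nrm b)\<^sup>2 + 2 * (nrm a * nrm b)"
    using complex_Re_le_cmod[of "ip a b"] Cauchy_Schwarz[of a b] by simp
  also have "\<dots> = (nrm a + nrm b)\<^sup>2" by (simp add: power2_sum)
  finally show ?thesis by (rule power2_le_imp_le) simp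
qed

text \<open>Gram-Schmidt, one spanning vector at a time: \<open>c\<close> is the part of the new
  vector \<open>b\<close> orthogonal to \<open>span B\<close>, and the old projection is corrected
  along \<open>c\<close>.\<close>

lemma ex_orthogonal_projection:
  assumes "finite B"
  shows "\<exists>x\<in>span B. \<forall>y\<in>span B. ip (v - x) y = 0"
proof -
  have orth: "ip u y = 0" if "\<And>z. z \<in> A \<Longrightarrow> ip u z = 0" "y \<in> span A" for u y A
    using that(2) by (induction rule: span_induct_alt) (auto simp: that(1) ip_add_right ip_scale_right)
  show ?thesis using assms
  proof (induction B arbitrary: v)
    case (insert b B)
    obtain p where p: "p \<in> span B" "\<And>y. y \<in> span B \<Longrightarrow> ip (v - p) y = 0" using insert.IH by blast
    obtain q where q: "q \<in> span B" "\<And>y. y \<in> span B \<Longrightarrow> ip (b - q) y = 0" using insert.IH by blast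
    have sub: "span B \<subseteq> span (insert b B)" by (rule span_mono) auto
    define c where "c = b - q"
    \<comment> \<open>\<open>B\<close> need not be independent: if \<open>b\<close> already lies in
      \<open>span B\<close>, then \<open>c = 0\<close> and nothing is corrected.\<close>
    define t where "t = (if c = 0 then 0 else ip v c / ip c c)"
    have pc: "ip p c = 0"
      using q(2)[OF p(1)] ip_conj[of p c] by (simp add: c_def)
    have B: "ip (v - (p + sm t c)) y = 0" if "y \<in> span B" for y
    proof -
      have "ip (v - (p + sm t c)) y = ip (v - p) y - t * ip c y"
        by (simp add: ip_diff_left ip_add_left ip_scale_left)
      then show ?thesis using p(2)[OF that] q(2)[OF that] by (simp add: c_def)
    qed
    moreover have "ip (v - (p + sm t c)) b = 0"
    proof -
      have "ip (v - (p + sm t c)) c = 0"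
        by (simp add: ip_diff_left ip_add_left ip_scale_left pc t_def)
      moreover have "ip (v - (p + sm t c)) (c + q) = ip (v - (p + sm t c)) c + ip (v - (p + sm t c)) q"
        by (rule ip_add_right)
      ultimately show ?thesis using B[OF q(1)] by (simp add: c_def)
    qed
    ultimately have "\<forall>y\<in>span (insert b B). ip (v - (p + sm t c)) y = 0"
      by (metis orth insert_iff span_base)
    moreover have "p + sm t c \<in> span (insert b B)"
      unfolding c_def using p(1) q(1) sub by (intro span_add span_scale span_diff) (auto intro: span_base)
    ultimately show ?case by blast
  qed auto
qed

text \<open>The Virasoro relation for L_0 and L_(-2), applied to the vacuum: L_(-2) maps it to
  \<open>nu\<close>, L_0 kills it, and the central term is absent because 0 + (-2) is not 0.\<close>

lemma nu_grade: "nu \<in> V 2"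
proof -
  obtain cc where cc: "\<And>m n b. Lop Y nu m (Lop Y nu n b) - Lop Y nu n (Lop Y nu m b)
          = sm (of_int (m - n)) (Lop Y nu (m + n) b)
            + (if m + n = 0 then sm (cc / 12 * of_int (m ^ 3 - m)) b else 0)"
    using Virasoro by blast
  show ?thesis
    using cc[of 0 "-2" vac] by (simp add: mem_grade Lop_def Y_vac_right)
qed

lemma L0_symmetric: "ip b (Y nu 1 c) = ip (Y nu 1 b) c"
  using ip_pmode[of b nu 0 c] by (simp add: pmode_homogeneous[OF nu_grade])

lemma grade_orthogonal: "a \<in> V d \<Longrightarrow> b \<in> V e \<Longrightarrow> d \<noteq> e \<Longrightarrow> ip a b = 0"
  using L0_symmetric[of a b] by (simp add: mem_grade ip_scale_left ip_scale_right)

lemma ip_pmode_left: "ip (md a n b) c = ip b (md (star a) (- n) c)"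
  using ip_pmode[of b "star a" "- n" c] by simp

section \<open>Adjoint modes\<close>

text \<open>The adjoint of \<open>Y a n\<close>: on the component of weight \<open>d\<close> this
  operator is the mode of index n - d + 1, and unitarity reverses the sign of the index.
  \<open>star (dec a d)\<close> need not be homogeneous, so \<open>md\<close> stays in the
  formula.\<close>

definition adj :: "'v \<Rightarrow> int \<Rightarrow> 'v \<Rightarrow> 'v" where
  "adj a n b = (\<Sum>d\<in>{d. dec a d \<noteq> 0}. md (star (dec a d)) (d - n - 1) b)"

lemma ip_adj: "ip (adj a n b) c = ip b (Y a n c)"
proof -
  have "Y a n c = (\<Sum>d\<in>{d. dec a d \<noteq> 0}. Y (dec a d) n c)"
    by (subst dec_sum[of a], rule Y_sum_left)
  moreover have "Y (dec a d) n c = md (dec a d) (- (d - n - 1)) c" for d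
    by (simp add: pmode_homogeneous[OF dec_grade])
  ultimately show ?thesis
    by (simp add: adj_def ip_sum_left ip_sum_right ip_pmode)
qed

lemma ip_adj_right: "ip c (adj a n b) = ip (Y a n c) b"
  using ip_adj[of a n b c] ip_conj by metis

lemma adj_add_left: "adj (a1 + a2) n b = adj a1 n b + adj a2 n b"
  by (rule ip_eqI) (simp add: ip_adj ip_add_left ip_add_right Y_add_left)

lemma adj_scale_left: "adj (sm k a) n b = sm (cnj k) (adj a n b)"
  by (rule ip_eqI) (simp add: ip_adj ip_scale_left ip_scale_right Y_scale_left)

lemma adj_add_right: "adj a n (b + c) = adj a n b + adj a n c"
  by (rule ip_eqI) (simp add: ip_adj ip_add_left)

lemma adj_scale_right: "adj a n (sm k b) = sm k (adj a n b)"
  by (rule ip_eqI) (simp add: ip_adj ip_scale_left)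

lemma adj_nu: "adj nu 1 b = Y nu 1 b"
  by (rule ip_eqI) (simp add: ip_adj L0_symmetric)

lemma adj_vac: "adj vac n b = (if n = -1 then b else 0)"
  by (rule ip_eqI) (simp add: ip_adj Y_vac_left)

text \<open>Weights are nonnegative, so the rise n + 1 - d is at most n + 1 whatever
  \<open>a\<close> is. This uniformity in \<open>a\<close> later puts all terms of a Borcherds sum
  on one energy level.\<close>

lemma adj_Vle: "b \<in> VL h \<Longrightarrow> adj a n b \<in> VL (h + n + 1)"
  unfolding adj_def
proof (rule subspace_sum[OF subspace_Vle])
  fix d assume b: "b \<in> VL h" and "d \<in> {d. dec a d \<noteq> 0}"
  then have "d \<ge> 0" using dec_nonneg by blast
  then show "md (star (dec a d)) (d - n - 1) b \<in> VL (h + n + 1)"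
    using pmode_Vle[OF b, of "star (dec a d)" "d - n - 1"] Vle_mono[of "h - (d - n - 1)" "h + n + 1"] by auto
qed

lemma Borcherds_sums:
  obtains N where "\<And>K. K \<ge> N \<Longrightarrow>
     (\<Sum>i<K. sm ((of_int p :: complex) gchoose i) (Y (Y a (r + int i) b) (p + q - int i) c)) =
     (\<Sum>i<K. sm ((-1) ^ i * ((of_int r :: complex) gchoose i))
                 (Y a (p + r - int i) (Y b (q + int i) c)
                  - sm ((-1::complex) powi r) (Y b (q + r - int i) (Y a (p + int i) c))))"
  using borcherds[of a b c p q r] unfolding borcherds_identity_def borcherds_sums_def fst_conv snd_conv by blast

section \<open>Sums of squares of modes as expectations of zero modes\<close>

definition expect :: "'v \<Rightarrow> 'v \<Rightarrow> complex" where
  "expect x b = ip b (md x 0 b)"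

lemma expect_add: "expect (x + y) b = expect x b + expect y b"
  by (simp add: expect_def pmode_add_left ip_add_right)

lemma expect_scale: "expect (sm k x) b = cnj k * expect x b"
  by (simp add: expect_def pmode_scale_left ip_scale_right)

lemma gbinomial_minus_one: "(-1) ^ i * (of_int (- 1) gchoose i) = (1 :: complex)"
  using gbinomial_minus[of "1 :: complex" i] binomial_gbinomial[of i i, where ?'a = complex]
  by (simp flip: power_mult_distrib mult.assoc)

text \<open>For each component c of \<open>star a\<close>, of weight \<open>e\<close>, take p = e -
  k, q = k + d - 1, r = -1. The left factors then have indices opposite to those of the right
  factors, so that pairing with \<open>b\<close> gives squares after summation over
  \<open>e\<close>. The expectations keep the sum over \<open>e\<close>, since their coefficients
  depend on \<open>e\<close>.\<close>

lemma sum_of_squares: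
  assumes a: "a \<in> V d"
  defines "J \<equiv> {e. dec (star a) e \<noteq> 0}"
  obtains N where "\<And>K. K \<ge> N \<Longrightarrow>
     of_real (\<Sum>i<K. (nrm (md a (k + int i) b))\<^sup>2 + (nrm (md (star a) (1 - k + int i) b))\<^sup>2)
     = (\<Sum>e\<in>J. \<Sum>i<K. cnj (of_int (e - k) gchoose i) * expect (Y (dec (star a) e) (int i - 1) a) b)"
proof -
  let ?s = "\<lambda>e. dec (star a) e"
  have ex: "\<forall>e. \<exists>N. \<forall>K\<ge>N. (\<Sum>i<K. sm (of_int (e - k) gchoose i) (md (Y (?s e) (int i - 1) a) 0 b))
      = (\<Sum>i<K. md (?s e) (- (k + int i)) (md a (k + int i) b) + md a (- (1 - k + int i)) (md (?s e) (1 - k + int i) b))"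
  proof
    fix e
    obtain N where N: "\<And>K. K \<ge> N \<Longrightarrow>
       (\<Sum>i<K. sm ((of_int (e - k) :: complex) gchoose i) (Y (Y (?s e) (- 1 + int i) a) (e - k + (k + d - 1) - int i) b)) =
       (\<Sum>i<K. sm ((-1) ^ i * ((of_int (- 1) :: complex) gchoose i))
                   (Y (?s e) (e - k + - 1 - int i) (Y a (k + d - 1 + int i) b)
                    - sm ((-1::complex) powi (- 1)) (Y a (k + d - 1 + - 1 - int i) (Y (?s e) (e - k + int i) b))))"
      using Borcherds_sums[of "e - k" "?s e" "-1" a "k + d - 1" b] by blast
    have 1: "Y (Y (?s e) (- 1 + int i) a) (e - k + (k + d - 1) - int i) b = md (Y (?s e) (int i - 1) a) 0 b" for i
    proof -
      have "Y (?s e) (int i - 1) a \<in> V (e + d - int i)"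
        using Y_grade[OF dec_grade a, of "star a" e "int i - 1"] by (simp add: add_diff_eq)
      from pmode_homogeneous[OF this, of 0 b] show ?thesis by (simp add: algebra_simps)
    qed
    have 2: "sm ((-1) ^ i * ((of_int (- 1) :: complex) gchoose i))
                   (Y (?s e) (e - k + - 1 - int i) (Y a (k + d - 1 + int i) b)
                    - sm ((-1::complex) powi (- 1)) (Y a (k + d - 1 + - 1 - int i) (Y (?s e) (e - k + int i) b)))
        = md (?s e) (- (k + int i)) (md a (k + int i) b) + md a (- (1 - k + int i)) (md (?s e) (1 - k + int i) b)" for i
      unfolding gbinomial_minus_one
      by (simp add: pmode_homogeneous[OF dec_grade] pmode_homogeneous[OF a] algebra_simps)
    show "\<exists>N. \<forall>K\<ge>N. (\<Sum>i<K. sm (of_int (e - k) gchoose i) (md (Y (?s e) (int i - 1) a) 0 b))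
      = (\<Sum>i<K. md (?s e) (- (k + int i)) (md a (k + int i) b) + md a (- (1 - k + int i)) (md (?s e) (1 - k + int i) b))"
      using N unfolding 1 2 by blast
  qed
  obtain N where N: "\<And>e K. K \<ge> N e \<Longrightarrow> (\<Sum>i<K. sm (of_int (e - k) gchoose i) (md (Y (?s e) (int i - 1) a) 0 b))
      = (\<Sum>i<K. md (?s e) (- (k + int i)) (md a (k + int i) b) + md a (- (1 - k + int i)) (md (?s e) (1 - k + int i) b))"
    using choice[OF ex] by blast
  have J: "finite J" by (simp add: J_def finite_dec)
  have star_eq: "md (star a) m c = (\<Sum>e\<in>J. md (?s e) m c)" for m c
    unfolding J_def by (rule pmode_dec)
  show ?thesis
  proof
    fix K assume K: "K \<ge> (\<Sum>e\<in>J. N e)"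
    have "(\<Sum>e\<in>J. \<Sum>i<K. cnj (of_int (e - k) gchoose i) * expect (Y (?s e) (int i - 1) a) b)
      = ip b (\<Sum>e\<in>J. \<Sum>i<K. sm (of_int (e - k) gchoose i) (md (Y (?s e) (int i - 1) a) 0 b))"
      by (simp add: expect_def ip_sum_right ip_scale_right)
    also have "(\<Sum>e\<in>J. \<Sum>i<K. sm (of_int (e - k) gchoose i) (md (Y (?s e) (int i - 1) a) 0 b))
      = (\<Sum>e\<in>J. \<Sum>i<K. md (?s e) (- (k + int i)) (md a (k + int i) b) + md a (- (1 - k + int i)) (md (?s e) (1 - k + int i) b))"
    proof (rule sum.cong[OF refl], rule N)
      fix e assume "e \<in> J"
      then show "N e \<le> K" using J K member_le_sum[of e J N] by simp
    qed
    also have "\<dots> = (\<Sum>i<K. \<Sum>e\<in>J. md (?s e) (- (k + int i)) (md a (k + int i) b) + md a (- (1 - k + int i)) (md (?s e) (1 - k + int i) b))"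
      by (rule sum.swap)
    also have "\<dots> = (\<Sum>i<K. md (star a) (- (k + int i)) (md a (k + int i) b) + md a (- (1 - k + int i)) (md (star a) (1 - k + int i) b))"
    proof (intro sum.cong refl)
      fix i
      have "md a m (sum f J) = (\<Sum>e\<in>J. md a m (f e))" for m f
        by (simp add: pmode_homogeneous[OF a] Y_sum_right)
      then show "(\<Sum>e\<in>J. md (?s e) (- (k + int i)) (md a (k + int i) b) + md a (- (1 - k + int i)) (md (?s e) (1 - k + int i) b))
        = md (star a) (- (k + int i)) (md a (k + int i) b) + md a (- (1 - k + int i)) (md (star a) (1 - k + int i) b)"
        by (simp only: sum.distrib star_eq)
    qed
    also have "ip b \<dots> = of_real (\<Sum>i<K. (nrm (md a (k + int i) b))\<^sup>2 + (nrm (md (star a) (1 - k + int i) b))\<^sup>2)"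
    proof -
      have "ip b (md (star x) (- m) (md x m b)) = of_real ((nrm (md x m b))\<^sup>2)" for x m
        by (subst ip_pmode) (simp add: ip_self)
      from this[of a] this[of "star a"] show ?thesis
        by (simp only: ip_sum_right ip_add_right of_real_sum of_real_add star_star)
    qed
    finally show "of_real (\<Sum>i<K. (nrm (md a (k + int i) b))\<^sup>2 + (nrm (md (star a) (1 - k + int i) b))\<^sup>2)
     = (\<Sum>e\<in>J. \<Sum>i<K. cnj (of_int (e - k) gchoose i) * expect (Y (dec (star a) e) (int i - 1) a) b)" by simp
  qed
qed

text \<open>Truncation of c_(i) a, for the finitely many components c of \<open>star a\<close>,
  leaves only \<open>i < I\<close> among the expectations, with \<open>I\<close> independent of
  \<open>k\<close> and \<open>b\<close>. All squares are nonnegative, so the term i = 0 alone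
  satisfies the bound.\<close>

lemma mode_bound_by_expect:
  assumes a: "a \<in> V d"
  obtains J I where "finite J" "\<And>k b.
     (nrm (md a k b))\<^sup>2 \<le> (\<Sum>e\<in>J. \<Sum>i<I. (1 + real_of_int \<bar>e - k\<bar>) ^ i * norm (expect (Y (dec (star a) e) (int i - 1) a) b)) \<and>
     (nrm (md (star a) (1 - k) b))\<^sup>2 \<le> (\<Sum>e\<in>J. \<Sum>i<I. (1 + real_of_int \<bar>e - k\<bar>) ^ i * norm (expect (Y (dec (star a) e) (int i - 1) a) b))"
proof -
  let ?s = "\<lambda>e. dec (star a) e"
  define J where "J = {e. ?s e \<noteq> 0}"
  have J: "finite J" by (simp add: J_def finite_dec)
  obtain T where T: "\<And>e n. n \<ge> T e \<Longrightarrow> Y (?s e) n a = 0"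
    using choice[of "\<lambda>e T. \<forall>n\<ge>T. Y (?s e) n a = 0"] Y_truncated by blast
  \<comment> \<open>The shift by 1 is there because the product has index i - 1.\<close>
  define I where "I = (\<Sum>e\<in>J. nat (T e + 1))"
  have zero: "expect (Y (?s e) (int i - 1) a) b = 0" if "e \<in> J" "i \<ge> I" for e i b
  proof -
    have "nat (T e + 1) \<le> I" unfolding I_def using J that(1) by (intro member_le_sum) auto
    then have "Y (?s e) (int i - 1) a = 0" using that(2) by (intro T) linarith
    then show ?thesis by (simp add: expect_def)
  qed
  show ?thesis
  proof (rule that[OF J, of I])
    fix k b
    let ?R = "\<Sum>e\<in>J. \<Sum>i<I. (1 + real_of_int \<bar>e - k\<bar>) ^ i * norm (expect (Y (?s e) (int i - 1) a) b)"
    obtain N where N: "\<And>K. K \<ge> N \<Longrightarrow>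
       of_real (\<Sum>i<K. (nrm (md a (k + int i) b))\<^sup>2 + (nrm (md (star a) (1 - k + int i) b))\<^sup>2)
       = (\<Sum>e\<in>J. \<Sum>i<K. cnj (of_int (e - k) gchoose i) * expect (Y (?s e) (int i - 1) a) b)"
      using sum_of_squares[OF a, of k b] unfolding J_def by blast
    \<comment> \<open>\<open>Suc\<close> guarantees that the term i = 0 is present.\<close>
    define K where "K = max (Suc N) I"
    let ?L = "\<Sum>i<K. (nrm (md a (k + int i) b))\<^sup>2 + (nrm (md (star a) (1 - k + int i) b))\<^sup>2"
    have "?L = norm (complex_of_real ?L)" by (simp add: sum_nonneg del: of_real_sum of_real_add)
    also have "complex_of_real ?L = (\<Sum>e\<in>J. \<Sum>i<K. cnj (of_int (e - k) gchoose i) * expect (Y (?s e) (int i - 1) a) b)"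
      by (rule N) (simp add: K_def)
    also have "\<dots> = (\<Sum>e\<in>J. \<Sum>i<I. cnj (of_int (e - k) gchoose i) * expect (Y (?s e) (int i - 1) a) b)"
      by (intro sum.cong refl sum.mono_neutral_right) (auto simp: K_def zero)
    also have "norm \<dots> \<le> ?R"
      by (intro sum_norm_le) (auto simp: norm_mult intro!: mult_right_mono norm_gbinomial_le_power_top[of "_ - _", simplified])
    finally have *: "?L \<le> ?R" .
    have "(nrm (md a (k + int 0) b))\<^sup>2 + (nrm (md (star a) (1 - k + int 0) b))\<^sup>2 \<le> ?L"
      by (rule member_le_sum) (auto simp: K_def)
    then have "(nrm (md a k b))\<^sup>2 + (nrm (md (star a) (1 - k) b))\<^sup>2 \<le> ?R" using * by simp
    then show "(nrm (md a k b))\<^sup>2 \<le> ?R \<and> (nrm (md (star a) (1 - k) b))\<^sup>2 \<le> ?R"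
      using zero_le_power2[of "nrm (md a k b)"] zero_le_power2[of "nrm (md (star a) (1 - k) b)"] by linarith
  qed
qed

lemma pmode_eq_0: "b \<in> VL n \<Longrightarrow> k > n \<Longrightarrow> md a k b = 0"
  using pmode_Vle[of b n a k] Vle_neg[of "n - k"] by auto

subsection \<open>Polynomial bounds\<close>

text \<open>Energy bounds with natural exponents and a pointwise estimate in place of the supremum.
  Levels below 0 can be left out because V has no vectors of negative weight.\<close>

definition poly_bounded :: "'v \<Rightarrow> bool" where
  "poly_bounded a \<longleftrightarrow> (\<exists>C s t. C \<ge> 0 \<and> (\<forall>N::nat. \<forall>m. \<forall>b\<in>VL (int N). nrm b \<le> 1 \<longrightarrow>
     nrm (md a m b) \<le> C * (1 + real_of_int \<bar>m\<bar>) ^ t * (1 + real N) ^ s))"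

lemma poly_bounded_if_energy_bounds:
  assumes "energy_bounds sm Y nu ip a"
  shows "poly_bounded a"
proof -
  obtain s C t where st: "s \<ge> 0" "C \<ge> 0" "t \<ge> 0"
    and H: "\<And>m n::int. opnorm_n sm Y nu ip (md a m) n
            \<le> ennreal (C * (1 + real_of_int \<bar>m\<bar>) powr t * (1 + real_of_int \<bar>n\<bar>) powr s)"
    using assms unfolding energy_bounds_def by blast
  have powr_le: "x powr r \<le> x ^ nat \<lceil>r\<rceil>" if "x \<ge> 1" "r \<ge> 0" for x r :: real
  proof -
    have "x powr r \<le> x powr real (nat \<lceil>r\<rceil>)" using that by (intro powr_mono) linarith+
    also have "\<dots> = x ^ nat \<lceil>r\<rceil>" using that by (intro powr_realpow) simp
    finally show ?thesis .
  qed
  show ?thesis unfolding poly_bounded_def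
  proof (intro exI conjI allI ballI impI)
    fix N m b assume b: "b \<in> VL (int N)" "nrm b \<le> 1"
    have "ennreal (nrm (md a m b)) \<le> opnorm_n sm Y nu ip (md a m) (int N)"
      unfolding opnorm_n_def using b by (intro Sup_upper) auto
    then have "ennreal (nrm (md a m b)) \<le> ennreal (C * (1 + real_of_int \<bar>m\<bar>) powr t * (1 + real_of_int \<bar>int N\<bar>) powr s)"
      using H order_trans by blast
    then have "nrm (md a m b) \<le> C * (1 + real_of_int \<bar>m\<bar>) powr t * (1 + real N) powr s"
      using st by (subst (asm) ennreal_le_iff) auto
    also have "\<dots> \<le> C * (1 + real_of_int \<bar>m\<bar>) ^ nat \<lceil>t\<rceil> * (1 + real N) ^ nat \<lceil>s\<rceil>"
      using st by (intro mult_mono powr_le mult_nonneg_nonneg) auto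
    finally show "nrm (md a m b) \<le> C * (1 + real_of_int \<bar>m\<bar>) ^ nat \<lceil>t\<rceil> * (1 + real N) ^ nat \<lceil>s\<rceil>" .
  qed (rule st)
qed

lemma energy_bounds_if_poly_bounded:
  assumes "poly_bounded a"
  shows "energy_bounds sm Y nu ip a"
proof -
  obtain C s t where C: "C \<ge> 0" and H: "\<And>N m b. b \<in> VL (int N) \<Longrightarrow> nrm b \<le> 1 \<Longrightarrow>
     nrm (md a m b) \<le> C * (1 + real_of_int \<bar>m\<bar>) ^ t * (1 + real N) ^ s"
    using assms unfolding poly_bounded_def by blast
  have "opnorm_n sm Y nu ip (md a m) n
            \<le> ennreal (C * (1 + real_of_int \<bar>m\<bar>) powr real t * (1 + real_of_int \<bar>n\<bar>) powr real s)" for m n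
    unfolding opnorm_n_def
  proof (rule Sup_least, clarify)
    fix b assume b: "b \<in> VL n" "nrm b \<le> 1"
    have "nrm (md a m b) \<le> C * (1 + real_of_int \<bar>m\<bar>) ^ t * (1 + real_of_int \<bar>n\<bar>) ^ s"
    proof (cases "n < 0")
      case True
      then have "b = 0" using b Vle_neg by blast
      then show ?thesis using C by simp
    next
      case False
      then show ?thesis using H[of b "nat n" m] b by simp
    qed
    also have "\<dots> = C * (1 + real_of_int \<bar>m\<bar>) powr real t * (1 + real_of_int \<bar>n\<bar>) powr real s"
      by (simp add: powr_realpow)
    finally show "ennreal (nrm (md a m b)) \<le> ennreal (C * (1 + real_of_int \<bar>m\<bar>) powr real t * (1 + real_of_int \<bar>n\<bar>) powr real s)"
      by (rule ennreal_leI)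
  qed
  then show ?thesis unfolding energy_bounds_def
    using C by (intro exI[of _ "real s"] exI[of _ C] exI[of _ "real t"]) auto
qed

lemma poly_bounded_zero: "poly_bounded 0"
  unfolding poly_bounded_def by (intro exI[of _ 0]) auto

lemma poly_bounded_add:
  assumes "poly_bounded a" "poly_bounded b"
  shows "poly_bounded (a + b)"
proof -
  obtain C s t where C: "C \<ge> 0" and H: "\<And>N m x. x \<in> VL (int N) \<Longrightarrow> nrm x \<le> 1 \<Longrightarrow>
     nrm (md a m x) \<le> C * (1 + real_of_int \<bar>m\<bar>) ^ t * (1 + real N) ^ s"
    using assms(1) unfolding poly_bounded_def by blast
  obtain C' s' t' where C': "C' \<ge> 0" and H': "\<And>N m x. x \<in> VL (int N) \<Longrightarrow> nrm x \<le> 1 \<Longrightarrow>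
     nrm (md b m x) \<le> C' * (1 + real_of_int \<bar>m\<bar>) ^ t' * (1 + real N) ^ s'"
    using assms(2) unfolding poly_bounded_def by blast
  show ?thesis unfolding poly_bounded_def
  proof (intro exI conjI allI ballI impI)
    fix N m x assume x: "x \<in> VL (int N)" "nrm x \<le> 1"
    let ?p = "1 + real_of_int \<bar>m\<bar>" and ?q = "1 + real N"
    have "nrm (md (a + b) m x) \<le> C * ?p ^ t * ?q ^ s + C' * ?p ^ t' * ?q ^ s'"
      using nrm_triangle[of "md a m x" "md b m x"] H[OF x, of m] H'[OF x, of m] by (simp add: pmode_add_left)
    also have "\<dots> \<le> C * ?p ^ max t t' * ?q ^ max s s' + C' * ?p ^ max t t' * ?q ^ max s s'"
      using C C' by (intro add_mono mult_mono power_increasing mult_nonneg_nonneg) auto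
    also have "\<dots> = (C + C') * ?p ^ max t t' * ?q ^ max s s'" by (simp add: algebra_simps)
    finally show "nrm (md (a + b) m x) \<le> (C + C') * ?p ^ max t t' * ?q ^ max s s'" .
  qed (use C C' in simp)
qed

lemma poly_bounded_if_components: "(\<And>d. poly_bounded (dec a d)) \<Longrightarrow> poly_bounded a"
proof -
  assume *: "\<And>d. poly_bounded (dec a d)"
  have "poly_bounded (sum (dec a) S)" if "finite S" for S
    using that by induction (simp_all add: poly_bounded_zero poly_bounded_add *)
  then show ?thesis by (subst dec_sum) (simp add: finite_dec)
qed

text \<open>Modes of index above N vanish on b, so for finite A only finitely many k matter.\<close>
definition controls :: "'v set \<Rightarrow> nat \<Rightarrow> nat \<Rightarrow> 'v \<Rightarrow> real \<Rightarrow> bool" where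
  "controls A K N b S \<longleftrightarrow> b \<in> VL (int N) \<and> nrm b \<le> 1 \<and> 0 \<le> S \<and>
     (\<forall>a\<in>A. \<forall>k\<ge>- int K. nrm (md a k b) \<le> S \<and> nrm (md (star a) k b) \<le> S)"

text \<open>Linearity in \<open>S\<close> is the point: it allows a factor \<open>S\<close> to be
  cancelled against \<open>S^2\<close>. The cutoff \<open>K\<close> may depend on \<open>f\<close>,
  since only finitely many such functions are ever combined and the largest cutoff serves
  all.\<close>

definition dominated :: "'v set \<Rightarrow> ('v \<Rightarrow> real) \<Rightarrow> bool" where
  "dominated A f \<longleftrightarrow> (\<exists>C s K. C \<ge> 0 \<and>
     (\<forall>N b S. controls A K N b S \<longrightarrow> f b \<le> C * (1 + real N) ^ s * S))"

lemma controls_antimono: "controls A K N b S \<Longrightarrow> K' \<le> K \<Longrightarrow> controls A K' N b S"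
  unfolding controls_def by (meson le_imp_neg_le of_nat_mono order_trans)

lemma controls_nonneg: "controls A K N b S \<Longrightarrow> 0 \<le> S"
  by (simp add: controls_def)

lemma dominated_mono: "dominated A g \<Longrightarrow> (\<And>b. f b \<le> g b) \<Longrightarrow> dominated A f"
  unfolding dominated_def by (meson order_trans)

lemma dominated_zero: "dominated A (\<lambda>_. 0)"
  unfolding dominated_def by (intro exI[of _ 0]) auto

lemma dominated_scale: "dominated A f \<Longrightarrow> c \<ge> 0 \<Longrightarrow> dominated A (\<lambda>b. c * f b)"
proof -
  assume "dominated A f" and c: "c \<ge> 0"
  then obtain C s K where H: "C \<ge> 0" "\<And>N b S. controls A K N b S \<Longrightarrow> f b \<le> C * (1 + real N) ^ s * S"
    unfolding dominated_def by blast
  show ?thesis unfolding dominated_def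
    using H(1) c mult_left_mono[OF H(2) c]
    by (intro exI[of _ "c * C"] exI[of _ s] exI[of _ K]) (auto simp: mult.assoc)
qed

lemma dominated_add:
  assumes "dominated A f" "dominated A g"
  shows "dominated A (\<lambda>b. f b + g b)"
proof -
  obtain C s K where H: "C \<ge> 0" "\<And>N b S. controls A K N b S \<Longrightarrow> f b \<le> C * (1 + real N) ^ s * S"
    using assms(1) unfolding dominated_def by blast
  obtain C' s' K' where H': "C' \<ge> 0" "\<And>N b S. controls A K' N b S \<Longrightarrow> g b \<le> C' * (1 + real N) ^ s' * S"
    using assms(2) unfolding dominated_def by blast
  show ?thesis unfolding dominated_def
  proof (intro exI conjI allI impI)
    fix N b S assume c: "controls A (max K K') N b S"
    have "f b + g b \<le> C * (1 + real N) ^ s * S + C' * (1 + real N) ^ s' * S"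
      using c by (intro add_mono H(2) H'(2)) (auto elim: controls_antimono)
    also have "\<dots> \<le> C * (1 + real N) ^ max s s' * S + C' * (1 + real N) ^ max s s' * S"
      using H(1) H'(1) controls_nonneg[OF c]
      by (intro add_mono mult_mono power_increasing mult_nonneg_nonneg) auto
    also have "\<dots> = (C + C') * (1 + real N) ^ max s s' * S" by (simp add: algebra_simps)
    finally show "f b + g b \<le> (C + C') * (1 + real N) ^ max s s' * S" .
  qed (use H(1) H'(1) in simp)
qed

lemma dominated_sum:
  "finite J \<Longrightarrow> (\<And>j. j \<in> J \<Longrightarrow> dominated A (f j)) \<Longrightarrow> dominated A (\<lambda>b. \<Sum>j\<in>J. f j b)"
  by (induction J rule: finite_induct) (auto simp: dominated_zero intro: dominated_add)

end

section \<open>Energy bounds from a finite generating set over U\<close>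

locale energy_bounded_sub = unitary_voa sm Y vac nu ip star
  for sm :: "complex \<Rightarrow> 'v::ab_group_add \<Rightarrow> 'v"
    and Y :: "'v \<Rightarrow> int \<Rightarrow> 'v \<Rightarrow> 'v"
    and vac nu :: 'v
    and ip :: "'v \<Rightarrow> 'v \<Rightarrow> complex"
    and star :: "'v \<Rightarrow> 'v" +
  fixes U :: "'v set"
  assumes is_subalgebra: "energy_bounded_subalgebra sm Y vac nu ip star U"
    and nu_in_U: "nu \<in> U"
begin

lemma subspace_U: "subspace U"
  and vac_in_U: "vac \<in> U"
  and Y_in_U: "a \<in> U \<Longrightarrow> b \<in> U \<Longrightarrow> Y a n b \<in> U"
  and star_in_U: "a \<in> U \<Longrightarrow> star a \<in> U"
  and poly_bounded_U: "a \<in> U \<Longrightarrow> poly_bounded a"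
  using is_subalgebra unfolding energy_bounded_subalgebra_def unitary_subalgebra_def
  by (auto simp: poly_bounded_if_energy_bounds)

lemma dec_in_U: "a \<in> U \<Longrightarrow> dec a d \<in> U"
  by (rule dec_in_subspace) (auto simp: subspace_U Y_in_U nu_in_U)

text \<open>In the zero mode of u_(n) a, each product of a mode of u with a mode of a is paired with b after
  moving the left factor to the other side of the scalar product, so that both factors act on b itself.
  This avoids any shift of the energy level N.\<close>
lemma expect_Y_dominated:
  assumes u: "u \<in> U" "u \<in> V e" and a: "a \<in> V d" "a \<in> A"
  shows "dominated A (\<lambda>b. norm (expect (Y u n a) b))"
proof -
  obtain C1 s1 t1 where C1: "C1 \<ge> 0" and H1: "\<And>N m b. b \<in> VL (int N) \<Longrightarrow> nrm b \<le> 1 \<Longrightarrow>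
     nrm (md u m b) \<le> C1 * (1 + real_of_int \<bar>m\<bar>) ^ t1 * (1 + real N) ^ s1"
    using poly_bounded_U[OF u(1)] unfolding poly_bounded_def by blast
  obtain C2 s2 t2 where C2: "C2 \<ge> 0" and H2: "\<And>N m b. b \<in> VL (int N) \<Longrightarrow> nrm b \<le> 1 \<Longrightarrow>
     nrm (md (star u) m b) \<le> C2 * (1 + real_of_int \<bar>m\<bar>) ^ t2 * (1 + real N) ^ s2"
    using poly_bounded_U[OF star_in_U[OF u(1)]] unfolding poly_bounded_def by blast
  \<comment> \<open>u_(n) a has weight e + d - n - 1, so its zero mode is the mode number
    \<open>q\<close>. \<open>K0\<close> is chosen so that the indices \<open>?k i\<close> and
    \<open>?k' i\<close> below are at least - K0, and exceed N once i > N + K0.\<close>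
  define q where "q = e + d - n - 2"
  define K0 where "K0 = nat (\<bar>e\<bar> + \<bar>n\<bar> + 1)"
  define w where "w = nat \<bar>n\<bar>"
  \<comment> \<open>One power for the number of summands, \<open>w\<close> for the binomial
    coefficient, and the rest for the modes of \<open>u\<close> and of
    \<open>star u\<close>.\<close>
  define P where "P = 1 + w + (t1 + s1) + (t2 + s2)"
  define D where "D = (C1 + C2) * real (1 + 2 * K0) ^ P"
  show ?thesis unfolding dominated_def
  proof (intro exI conjI allI impI)
    show "D \<ge> 0" using C1 C2 by (simp add: D_def)
    fix N b S assume ctl: "controls A K0 N b S"
    then have b: "b \<in> VL (int N)" "nrm b \<le> 1" and S: "0 \<le> S"
      and bd: "\<And>k. k \<ge> - int K0 \<Longrightarrow> nrm (md a k b) \<le> S" "\<And>k. k \<ge> - int K0 \<Longrightarrow> nrm (md (star a) k b) \<le> S"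
      using a(2) by (auto simp: controls_def)
    \<comment> \<open>A single quantity dominating 1 + N, 1 + i, 1 plus the absolute value of either
      index, and the number of summands.\<close>
    define M where "M = real (1 + 2 * K0) * (1 + real N)"
    have M: "1 + real N + 2 * real K0 \<le> M" by (simp add: M_def algebra_simps)
    have M1: "1 \<le> M" using M by linarith
    \<comment> \<open>With p = 0 only the term i = 0 survives on the left: this is the formula
      expressing the iterate u_(n) a through products of modes.\<close>
    obtain L where L: "\<And>K. K \<ge> L \<Longrightarrow>
     (\<Sum>i<K. sm ((of_int 0 :: complex) gchoose i) (Y (Y u (n + int i) a) (0 + q - int i) b)) =
     (\<Sum>i<K. sm ((-1) ^ i * ((of_int n :: complex) gchoose i))
                 (Y u (0 + n - int i) (Y a (q + int i) b)
                  - sm ((-1::complex) powi n) (Y a (q + n - int i) (Y u (0 + int i) b))))"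
      using Borcherds_sums[of 0 u n a q b] by blast
    define K where "K = Suc L"
    let ?k = "\<lambda>i::nat. e - 1 - n + int i" and ?k' = "\<lambda>i::nat. int i + 1 - e"
    let ?c = "\<lambda>i::nat. (-1) ^ i * ((of_int n :: complex) gchoose i)"
    let ?f = "\<lambda>i. cnj (?c i) * (ip (md (star u) (?k i) b) (md a (?k i) b)
                - cnj ((-1) powi n) * ip (md (star a) (?k' i) b) (md u (?k' i) b))"
    have "(\<Sum>i<K. sm ((of_int 0 :: complex) gchoose i) (Y (Y u (n + int i) a) (0 + q - int i) b))
      = (\<Sum>i\<in>{0::nat}. sm ((of_int 0 :: complex) gchoose i) (Y (Y u (n + int i) a) (0 + q - int i) b))"
    proof (intro sum.mono_neutral_right ballI)
      fix i assume "i \<in> {..<K} - {0::nat}"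
      then have "(of_int 0 :: complex) gchoose i = 0" by (cases i) auto
      then show "sm ((of_int 0 :: complex) gchoose i) (Y (Y u (n + int i) a) (0 + q - int i) b) = 0" by simp
    qed (auto simp: K_def)
    also have "\<dots> = md (Y u n a) 0 b"
      using pmode_homogeneous[OF Y_grade[OF u(2) a(1), of n], of 0 b] by (simp add: q_def algebra_simps)
    finally have "md (Y u n a) 0 b = (\<Sum>i<K. sm (?c i) (Y u (0 + n - int i) (Y a (q + int i) b)
                  - sm ((-1::complex) powi n) (Y a (q + n - int i) (Y u (0 + int i) b))))"
      using L[of K] by (simp add: K_def)
    also have "\<dots> = (\<Sum>i<K. sm (?c i) (md u (- ?k i) (md a (?k i) b)
                  - sm ((-1::complex) powi n) (md a (- ?k' i) (md u (?k' i) b))))"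
      by (simp add: pmode_homogeneous[OF u(2)] pmode_homogeneous[OF a(1)] q_def algebra_simps)
    finally have "expect (Y u n a) b = (\<Sum>i<K. ?f i)"
      by (simp only: expect_def ip_sum_right ip_scale_right ip_diff_right ip_pmode minus_minus) 
    \<comment> \<open>\<open>K\<close> depends on \<open>b\<close> in an uncontrolled way; the
      vanishing of modes of index above N replaces it by a number of terms linear in N.\<close>
    also have "\<dots> = (\<Sum>i\<in>{..<K} \<inter> {..N + K0}. ?f i)"
    proof (intro sum.mono_neutral_right ballI)
      fix i assume "i \<in> {..<K} - {..<K} \<inter> {..N + K0}"
      then have "i > N + K0" by auto
      then have "?k i > int N" "?k' i > int N" by (auto simp: K0_def)
      then show "?f i = 0" by (simp add: pmode_eq_0[OF b(1)])
    qed auto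
    also have "norm \<dots> \<le> (\<Sum>i\<in>{..<K} \<inter> {..N + K0}. M ^ w * ((C1 + C2) * M ^ ((t1 + s1) + (t2 + s2)) * S))"
    proof (rule sum_norm_le)
      fix i assume i: "i \<in> {..<K} \<inter> {..N + K0}"
      have kge: "?k i \<ge> - int K0" "?k' i \<ge> - int K0" by (auto simp: K0_def)
      have kM: "1 + real_of_int \<bar>?k i\<bar> \<le> M" "1 + real_of_int \<bar>?k' i\<bar> \<le> M"
      proof -
        have "\<bar>?k i\<bar> \<le> int N + 2 * int K0" "\<bar>?k' i\<bar> \<le> int N + 2 * int K0" using i by (auto simp: K0_def)
        then have "real_of_int \<bar>?k i\<bar> \<le> real_of_int (int N + 2 * int K0)"
          "real_of_int \<bar>?k' i\<bar> \<le> real_of_int (int N + 2 * int K0)" by (simp_all only: of_int_le_iff)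
        then show "1 + real_of_int \<bar>?k i\<bar> \<le> M" "1 + real_of_int \<bar>?k' i\<bar> \<le> M" using M by simp_all
      qed
      have NM: "1 + real N \<le> M" "1 + real i \<le> M" using M i by auto
      have unit: "norm ((-1::complex) powi n) = 1" by (simp add: norm_power_int)
      have p1: "nrm (md u (?k' i) b) \<le> C1 * M ^ ((t1 + s1) + (t2 + s2))"
      proof -
        have "nrm (md u (?k' i) b) \<le> C1 * (1 + real_of_int \<bar>?k' i\<bar>) ^ t1 * (1 + real N) ^ s1" by (rule H1[OF b])
        also have "\<dots> \<le> C1 * M ^ t1 * M ^ s1"
          using C1 kM NM M1 by (intro mult_mono power_mono mult_nonneg_nonneg) auto
        also have "\<dots> = C1 * M ^ (t1 + s1)" by (simp add: power_add)
        also have "\<dots> \<le> C1 * M ^ ((t1 + s1) + (t2 + s2))"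
          using C1 M1 by (intro mult_left_mono power_increasing) auto
        finally show ?thesis .
      qed
      have p2: "nrm (md (star u) (?k i) b) \<le> C2 * M ^ ((t1 + s1) + (t2 + s2))"
      proof -
        have "nrm (md (star u) (?k i) b) \<le> C2 * (1 + real_of_int \<bar>?k i\<bar>) ^ t2 * (1 + real N) ^ s2" by (rule H2[OF b])
        also have "\<dots> \<le> C2 * M ^ t2 * M ^ s2"
          using C2 kM NM M1 by (intro mult_mono power_mono mult_nonneg_nonneg) auto
        also have "\<dots> = C2 * M ^ (t2 + s2)" by (simp add: power_add)
        also have "\<dots> \<le> C2 * M ^ ((t1 + s1) + (t2 + s2))"
          using C2 M1 by (intro mult_left_mono power_increasing) auto
        finally show ?thesis .
      qed
      have "norm (ip (md (star u) (?k i) b) (md a (?k i) b)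
                - cnj ((-1) powi n) * ip (md (star a) (?k' i) b) (md u (?k' i) b))
         \<le> norm (ip (md (star u) (?k i) b) (md a (?k i) b)) + norm (ip (md (star a) (?k' i) b) (md u (?k' i) b))"
        using norm_triangle_ineq4[of "ip (md (star u) (?k i) b) (md a (?k i) b)"
            "cnj ((-1) powi n) * ip (md (star a) (?k' i) b) (md u (?k' i) b)"]
        by (simp only: norm_mult complex_mod_cnj unit mult_1)
      also have "\<dots> \<le> nrm (md (star u) (?k i) b) * nrm (md a (?k i) b) + nrm (md (star a) (?k' i) b) * nrm (md u (?k' i) b)"
        by (intro add_mono Cauchy_Schwarz)
      also have "\<dots> \<le> C2 * M ^ ((t1 + s1) + (t2 + s2)) * S + S * (C1 * M ^ ((t1 + s1) + (t2 + s2)))"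
        using S C1 C2 M1 by (intro add_mono mult_mono p1 p2 bd kge) auto
      also have "\<dots> = (C1 + C2) * M ^ ((t1 + s1) + (t2 + s2)) * S" by (simp add: algebra_simps)
      finally have *: "norm (ip (md (star u) (?k i) b) (md a (?k i) b)
                - cnj ((-1) powi n) * ip (md (star a) (?k' i) b) (md u (?k' i) b))
         \<le> (C1 + C2) * M ^ ((t1 + s1) + (t2 + s2)) * S" .
      have "norm (cnj (?c i)) \<le> M ^ w"
      proof -
        have "norm (cnj (?c i)) = norm (of_int n gchoose i :: complex)"
          by (simp add: norm_mult norm_power)
        also have "\<dots> \<le> (1 + real i) ^ w"
          unfolding w_def by (rule norm_gbinomial_le_power_bottom)
        also have "\<dots> \<le> M ^ w" using NM by (intro power_mono) auto
        finally show ?thesis .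
      qed
      with * show "norm (?f i) \<le> M ^ w * ((C1 + C2) * M ^ ((t1 + s1) + (t2 + s2)) * S)"
        unfolding norm_mult[of "cnj (?c i)"] using M1 by (intro mult_mono) auto
    qed
    also have "\<dots> \<le> M * (M ^ w * ((C1 + C2) * M ^ ((t1 + s1) + (t2 + s2)) * S))"
    proof -
      have "card ({..<K} \<inter> {..N + K0}) \<le> card {..N + K0}" by (rule card_mono) auto
      then have "real (card ({..<K} \<inter> {..N + K0})) \<le> 1 + real N + 2 * real K0" by simp
      then have "real (card ({..<K} \<inter> {..N + K0})) \<le> M" using M by linarith
      then show ?thesis
        unfolding sum_constant using S C1 C2 M1 by (intro mult_right_mono) auto
    qed
    also have "\<dots> = (C1 + C2) * M ^ P * S" by (simp add: P_def power_add)
    also have "\<dots> = D * (1 + real N) ^ P * S"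
      unfolding D_def M_def power_mult_distrib by simp
    finally show "norm (expect (Y u n a) b) \<le> D * (1 + real N) ^ P * S" .
  qed
qed

definition generates :: "'v set \<Rightarrow> bool" where
  "generates A \<longleftrightarrow> (\<forall>a\<in>A. \<exists>d. a \<in> V d) \<and>
     span {Y u n a | u n a. u \<in> U \<and> (\<exists>e. u \<in> V e) \<and> a \<in> A} = UNIV"

lemma expect_dominated:
  assumes "generates A"
  shows "dominated A (\<lambda>b. norm (expect x b))"
proof -
  have "x \<in> span {Y u n a | u n a. u \<in> U \<and> (\<exists>e. u \<in> V e) \<and> a \<in> A}"
    using assms by (simp add: generates_def)
  then show ?thesis
  proof (induction rule: span_induct_alt)
    case base
    have "expect 0 b = 0" for b by (simp add: expect_def)
    then show ?case by (simp add: dominated_zero)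
  next
    case (step c x y)
    have "dominated A (\<lambda>b. norm (expect x b))"
      using step(1) assms expect_Y_dominated unfolding generates_def by blast
    then have "dominated A (\<lambda>b. norm c * norm (expect x b) + norm (expect y b))"
      by (intro dominated_add dominated_scale step) auto
    then show ?case
    proof (rule dominated_mono)
      fix b
      show "norm (expect (sm c x + y) b) \<le> norm c * norm (expect x b) + norm (expect y b)"
        using norm_triangle_ineq[of "cnj c * expect x b" "expect y b"]
        by (simp add: expect_add expect_scale norm_mult)
    qed
  qed
qed

text \<open>\<open>f\<close> must not depend on \<open>k\<close>: the factor 1 + |e - k| is split
  into a part in \<open>k\<close>, taken out with exponent \<open>I\<close>, and a constant
  depending on \<open>e\<close>.\<close>

lemma modes_dominated:
  assumes A: "generates A" and a: "a \<in> V d"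
  shows "\<exists>I f. dominated A f \<and> (\<forall>b. 0 \<le> f b) \<and> (\<forall>k b. (nrm (md a k b))\<^sup>2 \<le> (1 + real_of_int \<bar>k\<bar>) ^ I * f b
     \<and> (nrm (md (star a) k b))\<^sup>2 \<le> (1 + real_of_int \<bar>k\<bar>) ^ I * f b)"
proof -
  obtain J I where J: "finite J" and H: "\<And>k b.
     (nrm (md a k b))\<^sup>2 \<le> (\<Sum>e\<in>J. \<Sum>i<I. (1 + real_of_int \<bar>e - k\<bar>) ^ i * norm (expect (Y (dec (star a) e) (int i - 1) a) b)) \<and>
     (nrm (md (star a) (1 - k) b))\<^sup>2 \<le> (\<Sum>e\<in>J. \<Sum>i<I. (1 + real_of_int \<bar>e - k\<bar>) ^ i * norm (expect (Y (dec (star a) e) (int i - 1) a) b))"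
    using mode_bound_by_expect[OF a] by blast
  define g where "g e i b = norm (expect (Y (dec (star a) e) (int i - 1) a) b)" for e i b
  define f where "f b = (\<Sum>e\<in>J. \<Sum>i<I. (2 + real_of_int \<bar>e\<bar>) ^ I * g e i b)" for b
  \<comment> \<open>The case k' = 1 - k serves \<open>star a\<close>, whose bound comes at index 1 -
    k.\<close>
  have main: "(\<Sum>e\<in>J. \<Sum>i<I. (1 + real_of_int \<bar>e - k\<bar>) ^ i * g e i b) \<le> (1 + real_of_int \<bar>k'\<bar>) ^ I * f b"
    if "k' = k \<or> k' = 1 - k" for k k' b
  proof -
    have "(1 + real_of_int \<bar>e - k\<bar>) ^ i * g e i b \<le> (1 + real_of_int \<bar>k'\<bar>) ^ I * ((2 + real_of_int \<bar>e\<bar>) ^ I * g e i b)"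
      if i: "i \<in> {..<I}" for e i
    proof -
      have "\<bar>e - k\<bar> \<le> \<bar>e\<bar> + 1 + \<bar>k'\<bar>" using \<open>k' = k \<or> k' = 1 - k\<close> by linarith
      moreover have "(1 + \<bar>k'\<bar>) * (2 + \<bar>e\<bar>) = 2 + \<bar>e\<bar> + 2 * \<bar>k'\<bar> + \<bar>k'\<bar> * \<bar>e\<bar>"
        by (simp add: algebra_simps)
      moreover have "0 \<le> \<bar>k'\<bar> * \<bar>e\<bar>" by (rule mult_nonneg_nonneg) simp_all
      ultimately have "1 + \<bar>e - k\<bar> \<le> (1 + \<bar>k'\<bar>) * (2 + \<bar>e\<bar>)"
        using abs_ge_zero[of k'] by linarith
      then have "real_of_int (1 + \<bar>e - k\<bar>) \<le> real_of_int ((1 + \<bar>k'\<bar>) * (2 + \<bar>e\<bar>))"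
        by (simp only: of_int_le_iff)
      then have "1 + real_of_int \<bar>e - k\<bar> \<le> (1 + real_of_int \<bar>k'\<bar>) * (2 + real_of_int \<bar>e\<bar>)" by simp
      then have "(1 + real_of_int \<bar>e - k\<bar>) ^ I \<le> ((1 + real_of_int \<bar>k'\<bar>) * (2 + real_of_int \<bar>e\<bar>)) ^ I"
        by (rule power_mono) simp
      moreover have "(1 + real_of_int \<bar>e - k\<bar>) ^ i \<le> (1 + real_of_int \<bar>e - k\<bar>) ^ I"
        using i by (intro power_increasing) auto
      ultimately have "(1 + real_of_int \<bar>e - k\<bar>) ^ i \<le> (1 + real_of_int \<bar>k'\<bar>) ^ I * (2 + real_of_int \<bar>e\<bar>) ^ I"
        by (simp add: power_mult_distrib)
      then have "(1 + real_of_int \<bar>e - k\<bar>) ^ i * g e i b \<le> (1 + real_of_int \<bar>k'\<bar>) ^ I * (2 + real_of_int \<bar>e\<bar>) ^ I * g e i b"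
        by (rule mult_right_mono) (simp add: g_def)
      then show ?thesis by (simp only: mult.assoc)
    qed
    then show ?thesis
      unfolding f_def sum_distrib_left by (intro sum_mono) auto
  qed
  show ?thesis
  proof (intro exI conjI allI)
    show "dominated A f"
      unfolding f_def g_def
      by (intro dominated_sum J finite_lessThan dominated_scale expect_dominated A) auto
    show "0 \<le> f b" for b by (auto simp: f_def g_def intro!: sum_nonneg)
    show "(nrm (md a k b))\<^sup>2 \<le> (1 + real_of_int \<bar>k\<bar>) ^ I * f b" for k b
      using H[of k b] main[of k k b] unfolding g_def by linarith
    show "(nrm (md (star a) k b))\<^sup>2 \<le> (1 + real_of_int \<bar>k\<bar>) ^ I * f b" for k b
      using H[of "1 - k" b] main[of k "1 - k" b] unfolding g_def by simp
  qed
qed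

text \<open>Because \<open>A\<close> and the set of relevant indices are finite, \<open>S\<close> is
  attained by some mode, to which the quadratic estimate applies. The caller prescribes
  \<open>K1\<close>, since the functions estimated later bring their own cutoff.\<close>

lemma generator_modes_bounded:
  assumes A: "generates A" "finite A"
  shows "\<exists>C s. C \<ge> 0 \<and> (\<forall>N b. b \<in> VL (int N) \<longrightarrow> nrm b \<le> 1 \<longrightarrow> controls A K1 N b (C * (1 + real N) ^ s))"
proof -
  have "\<forall>a\<in>A. \<exists>I f. dominated A f \<and> (\<forall>b. 0 \<le> f b) \<and> (\<forall>k b. (nrm (md a k b))\<^sup>2 \<le> (1 + real_of_int \<bar>k\<bar>) ^ I * f b
     \<and> (nrm (md (star a) k b))\<^sup>2 \<le> (1 + real_of_int \<bar>k\<bar>) ^ I * f b)"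
    using modes_dominated[OF A(1)] A(1) unfolding generates_def by blast
  from bchoice[OF this] obtain I where "\<forall>a\<in>A. \<exists>f. dominated A f \<and> (\<forall>b. 0 \<le> f b) \<and> (\<forall>k b. (nrm (md a k b))\<^sup>2 \<le> (1 + real_of_int \<bar>k\<bar>) ^ I a * f b
     \<and> (nrm (md (star a) k b))\<^sup>2 \<le> (1 + real_of_int \<bar>k\<bar>) ^ I a * f b)" by blast
  from bchoice[OF this] obtain f where
      dom: "\<And>a. a \<in> A \<Longrightarrow> dominated A (f a)"
    and pos: "\<And>a b. a \<in> A \<Longrightarrow> 0 \<le> f a b"
    and sq: "\<And>a k b. a \<in> A \<Longrightarrow> (nrm (md a k b))\<^sup>2 \<le> (1 + real_of_int \<bar>k\<bar>) ^ I a * f a b"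
       "\<And>a k b. a \<in> A \<Longrightarrow> (nrm (md (star a) k b))\<^sup>2 \<le> (1 + real_of_int \<bar>k\<bar>) ^ I a * f a b"
    by blast
  define F where "F b = (\<Sum>a\<in>A. f a b)" for b
  define J where "J = (\<Sum>a\<in>A. I a)"
  have "dominated A F"
    unfolding F_def using A(2) dom by (rule dominated_sum)
  then obtain C s K0 where C: "C \<ge> 0" and F: "\<And>N b S. controls A K0 N b S \<Longrightarrow> F b \<le> C * (1 + real N) ^ s * S"
    unfolding dominated_def by blast
  \<comment> \<open>\<open>K0\<close> is what the domination of \<open>F\<close> requires,
    \<open>K1\<close> what the conclusion requires.\<close>
  define K where "K = max K0 K1"
  have up: "(1 + real_of_int \<bar>k\<bar>) ^ I a * f a b \<le> (1 + real_of_int \<bar>k\<bar>) ^ J * F b" if "a \<in> A" for a k b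
    using that A(2) pos unfolding F_def J_def
    by (intro mult_mono power_increasing member_le_sum) auto
  show ?thesis
  proof (intro exI conjI allI impI)
    show "real (1 + K) ^ J * C \<ge> 0" using C by simp
    fix N b assume b: "b \<in> VL (int N)" "nrm b \<le> 1"
    \<comment> \<open>The element 0 keeps the maximum meaningful when \<open>A\<close> is
      empty.\<close>
    define T where "T = insert 0 ((\<lambda>(a, k). nrm (md a k b)) ` (A \<times> {- int K..int N}) \<union>
        (\<lambda>(a, k). nrm (md (star a) k b)) ` (A \<times> {- int K..int N}))"
    define S where "S = Max T"
    have T: "finite T" using A(2) by (simp add: T_def)
    have "S \<ge> 0" unfolding S_def using T by (intro Max_ge) (auto simp: T_def)
    have ctl: "controls A K N b S"
      unfolding controls_def
    proof (intro conjI ballI allI impI b \<open>S \<ge> 0\<close>)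
      fix a k assume ak: "a \<in> A" "- int K \<le> k"
      have "nrm (md a k b) \<le> S \<and> nrm (md (star a) k b) \<le> S"
      proof (cases "k \<le> int N")
        case True
        then have "(a, k) \<in> A \<times> {- int K..int N}" using ak by simp
        from imageI[OF this, of "\<lambda>(a, k). nrm (md a k b)"]
          imageI[OF this, of "\<lambda>(a, k). nrm (md (star a) k b)"]
        show ?thesis unfolding S_def by (intro conjI Max_ge[OF T]) (simp_all add: T_def)
      next
        case False
        then show ?thesis using \<open>S \<ge> 0\<close> by (simp add: pmode_eq_0[OF b(1)])
      qed
      then show "nrm (md a k b) \<le> S" "nrm (md (star a) k b) \<le> S" by auto
    qed
    then have FS: "F b \<le> C * (1 + real N) ^ s * S"
      using controls_antimono by (intro F) (auto simp: K_def)
    \<comment> \<open>The factors with exponent \<open>J\<close> come from 1 + |k| \<le> (1 + K) (1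
      + N), valid for k between - K and N.\<close>
    define B where "B = real (1 + K) ^ J * C * (1 + real N) ^ (J + s)"
    have "B \<ge> 0" using C by (simp add: B_def)
    have bnd: "(1 + real_of_int \<bar>k\<bar>) ^ J * F b \<le> B * S" if "k \<in> {- int K..int N}" for k
    proof -
      have "real_of_int \<bar>k\<bar> \<le> real K + real N" using that by auto
      moreover have "real (1 + K) * (1 + real N) = 1 + (real K + real N) + real K * real N"
        by (simp add: algebra_simps)
      moreover have "0 \<le> real K * real N" by (rule mult_nonneg_nonneg) simp_all
      ultimately have "1 + real_of_int \<bar>k\<bar> \<le> real (1 + K) * (1 + real N)" by linarith
      then have "(1 + real_of_int \<bar>k\<bar>) ^ J \<le> (real (1 + K) * (1 + real N)) ^ J" by (rule power_mono) simp
      then have "(1 + real_of_int \<bar>k\<bar>) ^ J * F b \<le> (real (1 + K) * (1 + real N)) ^ J * (C * (1 + real N) ^ s * S)"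
        using FS pos by (intro mult_mono) (auto simp: F_def intro: sum_nonneg)
      also have "\<dots> = B * S"
        unfolding B_def power_mult_distrib power_add by (simp only: mult_ac)
      finally show ?thesis .
    qed
    have "S \<in> T" unfolding S_def using T by (intro Max_in) (auto simp: T_def)
    then have "S = 0 \<or> S\<^sup>2 \<le> B * S"
      using sq up bnd unfolding T_def by (fastforce intro: order_trans)
    then have "S \<le> B"
      using \<open>S \<ge> 0\<close> \<open>B \<ge> 0\<close> by (auto simp: power2_eq_square mult_le_cancel_right)
    then have "controls A K N b B"
      using ctl \<open>S \<ge> 0\<close> unfolding controls_def by (meson order_trans)
    then show "controls A K1 N b (real (1 + K) ^ J * C * (1 + real N) ^ (J + s))"
      unfolding B_def by (rule controls_antimono) (simp add: K_def)
  qed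
qed

text \<open>Control of the generators on indices above a cutoff suffices to bound \<open>f\<close>;
  \<open>modes_dominated\<close> then reaches every index, however negative, at the price of a power
  of 1 + |m|.\<close>

lemma poly_bounded_if_finitely_generated:
  assumes A: "generates A" "finite A"
  shows "poly_bounded a"
proof (rule poly_bounded_if_components)
  fix d
  obtain I f where f: "dominated A f" "\<And>b. 0 \<le> f b"
    and sq: "\<And>k b. (nrm (md (dec a d) k b))\<^sup>2 \<le> (1 + real_of_int \<bar>k\<bar>) ^ I * f b"
    using modes_dominated[OF A(1) dec_grade[of a d]] by blast
  obtain C s K where C: "C \<ge> 0" and H: "\<And>N b S. controls A K N b S \<Longrightarrow> f b \<le> C * (1 + real N) ^ s * S"
    using f(1) unfolding dominated_def by blast
  obtain C' s' where C': "C' \<ge> 0"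
    and H': "\<And>N b. b \<in> VL (int N) \<Longrightarrow> nrm b \<le> 1 \<Longrightarrow> controls A K N b (C' * (1 + real N) ^ s')"
    using generator_modes_bounded[OF A] by blast
  show "poly_bounded (dec a d)" unfolding poly_bounded_def
  proof (intro exI conjI allI ballI impI)
    show "1 + C * C' \<ge> 0" using C C' by simp
    fix N m b assume b: "b \<in> VL (int N)" "nrm b \<le> 1"
    \<comment> \<open>The summand 1 makes \<open>?x\<close> at least 1, hence at most its square, so
      no square roots of the exponents are needed.\<close>
    let ?x = "(1 + C * C') * (1 + real_of_int \<bar>m\<bar>) ^ I * (1 + real N) ^ (s + s')"
    have "1 * 1 * 1 \<le> ?x" using C C' by (intro mult_mono) auto
    have "(nrm (md (dec a d) m b))\<^sup>2 \<le> (1 + real_of_int \<bar>m\<bar>) ^ I * (C * (1 + real N) ^ s * (C' * (1 + real N) ^ s'))"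
      by (rule order_trans[OF sq mult_left_mono[OF H[OF H'[OF b]]]]) simp
    also have "\<dots> = (C * C') * (1 + real_of_int \<bar>m\<bar>) ^ I * (1 + real N) ^ (s + s')"
      by (simp add: power_add)
    also have "\<dots> \<le> ?x" by (intro mult_right_mono) auto
    also have "\<dots> \<le> ?x\<^sup>2" using \<open>1 * 1 * 1 \<le> ?x\<close> by (intro self_le_power) auto
    finally show "nrm (md (dec a d) m b) \<le> ?x"
      by (rule power2_le_imp_le) (use \<open>1 * 1 * 1 \<le> ?x\<close> in linarith)
  qed
qed

subsection \<open>Generation by low weights\<close>

definition Gen :: "'v set \<Rightarrow> 'v set" where
  "Gen A = span {Y u n a | u n a. u \<in> U \<and> (\<exists>e. u \<in> V e) \<and> a \<in> A}"

lemma subspace_Gen: "subspace (Gen A)"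
  by (simp add: Gen_def)

lemma Y_in_Gen:
  assumes "u \<in> U" "a \<in> A"
  shows "Y u n a \<in> Gen A"
proof -
  have "(\<Sum>d\<in>{d. dec u d \<noteq> 0}. Y (dec u d) n a) \<in> Gen A"
    unfolding Gen_def using assms dec_in_U dec_grade by (intro span_sum span_base) blast
  then show ?thesis
    by (subst dec_sum[of u]) (simp only: Y_sum_left)
qed

text \<open>One mode of U is enough to span the submodule generated by \<open>A\<close>. With
  \<open>p\<close> beyond the truncation of \<open>u\<close> on \<open>a\<close> and r = m - p, all
  products with \<open>u\<close> acting first vanish, the iterates lie in \<open>Gen A\<close>, and
  the products with i \<ge> 1 have a larger index \<open>q + i\<close> on \<open>v\<close>. Downward
  induction on \<open>q\<close> from the truncation of \<open>v\<close> isolates the term i =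
  0.\<close>

lemma Y_Y_in_Gen:
  assumes "u \<in> U" "v \<in> U" "a \<in> A"
  shows "Y u m (Y v q a) \<in> Gen A"
proof -
  obtain Q where Q: "\<And>n. n \<ge> Q \<Longrightarrow> Y v n a = 0" using Y_truncated by blast
  obtain p where p: "\<And>n. n \<ge> p \<Longrightarrow> Y u n a = 0" using Y_truncated by blast
  show ?thesis
  proof (induction "nat (Q - q)" arbitrary: q m rule: less_induct)
    case less
    show ?case
    proof (cases "q \<ge> Q")
      case True
      then show ?thesis using Q subspace_0[OF subspace_Gen] by simp
    next
      case False
      let ?r = "m - p"
      let ?t = "\<lambda>i. sm ((-1) ^ i * ((of_int ?r :: complex) gchoose i))
                 (Y u (p + ?r - int i) (Y v (q + int i) a)
                  - sm ((-1::complex) powi ?r) (Y v (q + ?r - int i) (Y u (p + int i) a)))"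
      obtain L where L: "\<And>K. K \<ge> L \<Longrightarrow>
       (\<Sum>i<K. sm ((of_int p :: complex) gchoose i) (Y (Y u (?r + int i) v) (p + q - int i) a)) =
       (\<Sum>i<K. ?t i)"
        using Borcherds_sums[of p u ?r v q a] by blast
      have "(\<Sum>i<Suc L. ?t i) \<in> Gen A"
        unfolding L[of "Suc L", simplified, symmetric]
        by (subst L[symmetric], simp)
          (intro subspace_sum[OF subspace_Gen] subspace_scale[OF subspace_Gen] Y_in_Gen Y_in_U assms)
      moreover have "(\<Sum>i<L. ?t (Suc i)) \<in> Gen A"
      proof (intro subspace_sum[OF subspace_Gen] subspace_scale[OF subspace_Gen])
        fix i
        have "Y u (p + ?r - int (Suc i)) (Y v (q + int (Suc i)) a) \<in> Gen A"
          using False by (intro less) auto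
        then show "Y u (p + ?r - int (Suc i)) (Y v (q + int (Suc i)) a)
                  - sm ((-1::complex) powi ?r) (Y v (q + ?r - int (Suc i)) (Y u (p + int (Suc i)) a)) \<in> Gen A"
          by (simp add: p)
      qed
      ultimately have "(\<Sum>i<Suc L. ?t i) - (\<Sum>i<L. ?t (Suc i)) \<in> Gen A"
        by (rule subspace_diff[OF subspace_Gen])
      then have "?t 0 \<in> Gen A"
        unfolding sum.lessThan_Suc_shift[of ?t] add_diff_cancel_right' .
      then show ?thesis by (simp add: p)
    qed
  qed
qed

lemma Y_Gen_closed:
  assumes "u \<in> U" "x \<in> Gen A"
  shows "Y u m x \<in> Gen A"
  using assms(2) unfolding Gen_def[of A]
proof (induction rule: span_induct_alt)
  case (step c x y)
  then have "Y u m x \<in> Gen A" using assms(1) Y_Y_in_Gen by blast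
  then show ?case
    using step by (simp add: Y_add_right Y_scale_right subspace_add subspace_scale Gen_def)
qed (simp add: span_zero)

lemma subset_Gen: "A \<subseteq> Gen A"
  using Y_in_Gen[OF vac_in_U, of _ A "-1"] by (auto simp: Y_vac_left)

text \<open>For \<open>u\<close> of weight \<open>d\<close>, the operator \<open>Y u n\<close>
  shifts weights by d - n - 1, so the modes with n \<ge> d are those that lower the weight.\<close>

definition lowest_weight :: "int \<Rightarrow> 'v set" where
  "lowest_weight h = {w \<in> V h. \<forall>u d n. u \<in> U \<longrightarrow> u \<in> V d \<longrightarrow> n \<ge> d \<longrightarrow> Y u n w = 0}"

text \<open>In V_h, let \<open>X\<close> be the vectors reached by one mode of U from smaller
  weight. A vector orthogonal to \<open>X\<close> is a lowest weight vector, since adjoints of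
  lowering modes of U are raising modes of U; for h > H it vanishes. Finite dimension of V_h
  supplies the orthogonal projection.\<close>

lemma grade_subset_Gen:
  assumes H: "\<And>h. h > H \<Longrightarrow> lowest_weight h \<subseteq> {0}"
  defines "G \<equiv> Gen (\<Union>k\<in>{0..H}. V k)"
  shows "V h \<subseteq> G"
proof (cases "h < 0")
  case True
  then show ?thesis by (simp add: grade_neg G_def subspace_0[OF subspace_Gen])
next
  case False
  then show ?thesis
  proof (induction "nat h" arbitrary: h rule: less_induct)
    case less
    show ?case
    proof (cases "h \<le> H")
      case True
      then have "V h \<subseteq> (\<Union>k\<in>{0..H}. V k)" using less.prems by fastforce
      then show ?thesis unfolding G_def using subset_Gen by blast
    next
      case False
      define X where "X = {Y u n x | u d n x h'. u \<in> U \<and> u \<in> V d \<and> x \<in> V h' \<and> h' < h \<and> d + h' - n - 1 = h}"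
      have "X \<subseteq> V h" unfolding X_def using Y_grade by blast
      then have sX: "span X \<subseteq> V h" by (rule span_minimal) (rule subspace_grade)
      have "V h' \<subseteq> G" if "h' < h" for h'
      proof (cases "h' < 0")
        case True
        then show ?thesis by (simp add: grade_neg G_def subspace_0[OF subspace_Gen])
      next
        case False
        then show ?thesis using that by (intro less.hyps) auto
      qed
      then have "X \<subseteq> G" unfolding X_def G_def using Y_Gen_closed by blast
      then have XG: "span X \<subseteq> G" unfolding G_def by (rule span_minimal) (rule subspace_Gen)
      obtain T where "finite T" "V h \<subseteq> span T" using ex_finite_span_grade by blast
      then obtain B where B: "finite B" "B \<subseteq> span X" "span X \<subseteq> span B"
        using ex_finite_span_subspace[of "span X" T] sX by blast
      show ?thesis
      proof
        fix v assume v: "v \<in> V h"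
        obtain x where x: "x \<in> span B" "\<And>y. y \<in> span B \<Longrightarrow> ip (v - x) y = 0"
          using ex_orthogonal_projection[OF B(1)] by blast
        have xX: "x \<in> span X" using x(1) B(2) span_minimal[OF _ subspace_span] by blast
        define w where "w = v - x"
        have w: "w \<in> V h" unfolding w_def using v xX sX subspace_grade by (blast intro: subspace_diff)
        have "w \<in> lowest_weight h" unfolding lowest_weight_def
        proof (clarify, intro conjI allI impI w)
          fix u d n assume u: "u \<in> U" "u \<in> V d" and n: "n \<ge> d"
          define y where "y = Y u n w"
          have y: "y \<in> V (d + h - n - 1)" unfolding y_def by (rule Y_grade[OF u(2) w])
          \<comment> \<open>The adjoint of \<open>Y u n\<close>, applied to
            \<open>y = Y u n w\<close>, raises the weight back to \<open>h\<close>; orthogonality of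
            \<open>w\<close> to \<open>X\<close> then says that the norm of \<open>y\<close> is
            zero.\<close>
          have "md (star u) (d - n - 1) y \<in> span X"
            unfolding pmode_eq
          proof (intro span_sum span_base)
            fix e
            have "dec (star u) e \<in> U" "dec (star u) e \<in> V e"
              using dec_in_U star_in_U u(1) dec_grade by auto
            moreover have "d + h - n - 1 < h" using n by simp
            moreover have "e + (d + h - n - 1) - (d - n - 1 + e - 1) - 1 = h" by simp
            ultimately show "Y (dec (star u) e) (d - n - 1 + e - 1) y \<in> X"
              unfolding X_def using y by blast
          qed
          then have "ip w (md (star u) (d - n - 1) y) = 0"
            using x(2) B(3) unfolding w_def by blast
          moreover have "ip w (md (star u) (d - n - 1) y) = ip y y"
          proof -
            have "y = md u (n - d + 1) w" by (simp add: y_def pmode_homogeneous[OF u(2)])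
            then show ?thesis using ip_pmode_left[of u "n - d + 1" w y] by (simp add: algebra_simps)
          qed
          ultimately show "Y u n w = 0" by (simp add: y_def)
        qed
        then have "w = 0" using H[of h] False by auto
        then show "v \<in> G" using xX XG by (auto simp: w_def)
      qed
    qed
  qed
qed

lemma ex_finite_generators:
  assumes "\<And>h. h > H \<Longrightarrow> lowest_weight h \<subseteq> {0}"
  shows "\<exists>A. finite A \<and> generates A"
proof -
  have "\<forall>k. \<exists>B. finite B \<and> B \<subseteq> V k \<and> V k \<subseteq> span B"
    using ex_finite_span_grade ex_finite_span_subspace by blast
  from choice[OF this] obtain B where B: "\<And>k. finite (B k)" "\<And>k. B k \<subseteq> V k" "\<And>k. V k \<subseteq> span (B k)"
    by blast
  define A where "A = (\<Union>k\<in>{0..H}. B k)"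
  have "Y u n x \<in> Gen A" if "u \<in> U" "x \<in> V k" "k \<in> {0..H}" for u n x k
  proof -
    have "x \<in> span (B k)" using B(3) that by blast
    then show ?thesis
    proof (induction rule: span_induct_alt)
      case (step c x y)
      then have "Y u n x \<in> Gen A" using that by (intro Y_in_Gen) (auto simp: A_def)
      then show ?case using step
        by (simp add: Y_add_right Y_scale_right subspace_add[OF subspace_Gen] subspace_scale[OF subspace_Gen])
    qed (simp add: subspace_0[OF subspace_Gen])
  qed
  then have "Gen (\<Union>k\<in>{0..H}. V k) \<subseteq> Gen A"
    unfolding Gen_def[of "\<Union>k\<in>{0..H}. V k"]
    by (intro span_minimal subspace_Gen) blast
  then have "V h \<subseteq> Gen A" for h using grade_subset_Gen[OF assms, where h = h] by blast
  then have "sum (dec v) {d. dec v d \<noteq> 0} \<in> Gen A" for v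
    using dec_grade by (intro subspace_sum[OF subspace_Gen]) blast
  then have "v \<in> Gen A" for v by (subst dec_sum)
  moreover have "\<forall>a\<in>A. \<exists>d. a \<in> V d" using B(2) by (auto simp: A_def)
  moreover have "finite A" using B(1) by (simp add: A_def)
  ultimately show ?thesis unfolding generates_def Gen_def by blast
qed

subsection \<open>The algebraic completion\<close>

lemma ex_spanning_sequence: "\<exists>s :: nat \<Rightarrow> 'v. span (range s) = UNIV"
proof -
  obtain F where F: "\<And>k. finite (F k)" "\<And>k. V k \<subseteq> span (F k)"
    using choice[of "\<lambda>k B. finite B \<and> V k \<subseteq> span B"] ex_finite_span_grade by blast
  \<comment> \<open>The vector 0 ensures that the countable set is nonempty and so has an
    enumeration.\<close>
  define B where "B = insert 0 (\<Union>k. F k)"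
  have "countable B" unfolding B_def using F(1) by (auto intro: countable_finite)
  then have s: "range (from_nat_into B) = B" by (rule range_from_nat_into[rotated]) (simp add: B_def)
  have "V k \<subseteq> span B" for k
    using F(2)[of k] span_mono[of "F k" B] by (auto simp: B_def)
  then have "sum (dec v) {d. dec v d \<noteq> 0} \<in> span B" for v
    using dec_grade by (intro span_sum) blast
  then have "v \<in> span B" for v by (subst dec_sum)
  then show ?thesis using s by (intro exI[of _ "from_nat_into B"]) auto
qed

definition spanning :: "nat \<Rightarrow> 'v" where
  "spanning = (SOME s. span (range s) = UNIV)"

lemma span_spanning: "span (range spanning) = UNIV"
  unfolding spanning_def by (rule someI_ex[OF ex_spanning_sequence])

text \<open>The admissible functionals are the vectors of the algebraic completion of V on which every
  vertex operator of U is truncated; they are encoded in the type of the module carriers by their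
  values on a spanning sequence.\<close>
definition antilinear :: "('v \<Rightarrow> complex) \<Rightarrow> bool" where
  "antilinear F \<longleftrightarrow> (\<forall>x y. F (x + y) = F x + F y) \<and> (\<forall>k x. F (sm k x) = cnj k * F x)"

definition admissible :: "('v \<Rightarrow> complex) \<Rightarrow> bool" where
  "admissible F \<longleftrightarrow> antilinear F \<and> (\<forall>u\<in>U. \<exists>N. \<forall>n\<ge>N. \<forall>v. F (adj u n v) = 0)"

definition encode :: "('v \<Rightarrow> complex) \<Rightarrow> nat \<Rightarrow> complex" where
  "encode F i = F (spanning i)"

definition decode :: "(nat \<Rightarrow> complex) \<Rightarrow> 'v \<Rightarrow> complex" where
  "decode w = (SOME F. admissible F \<and> encode F = w)"

definition completion :: "(nat \<Rightarrow> complex) set" where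
  "completion = {encode F | F. admissible F}"

text \<open>For \<open>F v = ip w v\<close> this is the pairing with \<open>Y u n w\<close>, so the
  action extends that of U on V. It is linear in \<open>u\<close>, because \<open>adj\<close> and
  \<open>F\<close> are both antilinear.\<close>

definition act :: "'v \<Rightarrow> int \<Rightarrow> ('v \<Rightarrow> complex) \<Rightarrow> 'v \<Rightarrow> complex" where
  "act u n F v = F (adj u n v)"

definition YC :: "'v \<Rightarrow> int \<Rightarrow> (nat \<Rightarrow> complex) \<Rightarrow> nat \<Rightarrow> complex" where
  "YC u n w = encode (act u n (decode w))"

lemma antilinear_add: "antilinear F \<Longrightarrow> F (x + y) = F x + F y"
  and antilinear_scale: "antilinear F \<Longrightarrow> F (sm k x) = cnj k * F x"
  by (auto simp: antilinear_def)

lemma antilinear_zero: "antilinear F \<Longrightarrow> F 0 = 0"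
  using antilinear_scale[of F 0 0] by simp

lemma antilinear_diff: "antilinear F \<Longrightarrow> F (x - y) = F x - F y"
  using antilinear_add[of F "x - y" y] by simp

lemma antilinear_sum: "antilinear F \<Longrightarrow> F (sum f S) = (\<Sum>x\<in>S. F (f x))"
  by (induction S rule: infinite_finite_induct) (auto simp: antilinear_zero antilinear_add)

lemma encode_inject:
  assumes F: "antilinear F" and G: "antilinear G" and eq: "encode F = encode G"
  shows "F = G"
proof
  fix v
  have "v \<in> span (range spanning)" by (simp add: span_spanning)
  then show "F v = G v"
  proof (induction rule: span_induct_alt)
    case (step c x y)
    then have "F x = G x" using fun_cong[OF eq] by (auto simp: encode_def)
    then show ?case using step by (simp add: antilinear_add[OF F] antilinear_add[OF G]
          antilinear_scale[OF F] antilinear_scale[OF G])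
  qed (simp add: antilinear_zero F G)
qed

lemma admissible_antilinear: "admissible F \<Longrightarrow> antilinear F"
  by (simp add: admissible_def)

lemma decode_encode: "admissible F \<Longrightarrow> decode (encode F) = F"
proof -
  assume F: "admissible F"
  then have "admissible (decode (encode F)) \<and> encode (decode (encode F)) = encode F"
    unfolding decode_def by (intro someI[of "\<lambda>G. admissible G \<and> encode G = encode F" F]) simp
  then show ?thesis using F encode_inject admissible_antilinear by blast
qed

lemma YC_encode: "admissible F \<Longrightarrow> YC u n (encode F) = encode (act u n F)"
  by (simp add: YC_def decode_encode)

lemma antilinear_act: "antilinear F \<Longrightarrow> antilinear (act u n F)"
  by (auto simp: antilinear_def act_def adj_add_right adj_scale_right)

lemma admissible_zero: "admissible (\<lambda>_. 0)"
  by (simp add: admissible_def antilinear_def)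

lemma admissible_add: "admissible F \<Longrightarrow> admissible G \<Longrightarrow> admissible (\<lambda>v. F v + G v)"
  unfolding admissible_def
proof (intro conjI ballI)
  fix u assume F: "antilinear F \<and> (\<forall>u\<in>U. \<exists>N. \<forall>n\<ge>N. \<forall>v. F (adj u n v) = 0)"
    and G: "antilinear G \<and> (\<forall>u\<in>U. \<exists>N. \<forall>n\<ge>N. \<forall>v. G (adj u n v) = 0)" and u: "u \<in> U"
  obtain N where N: "\<And>n v. n \<ge> N \<Longrightarrow> F (adj u n v) = 0" using F u by blast
  obtain N' where N': "\<And>n v. n \<ge> N' \<Longrightarrow> G (adj u n v) = 0" using G u by blast
  show "\<exists>N. \<forall>n\<ge>N. \<forall>v. F (adj u n v) + G (adj u n v) = 0"
    by (intro exI[of _ "max N N'"]) (simp add: N N')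
qed (auto simp: antilinear_def algebra_simps)

lemma admissible_scale: "admissible F \<Longrightarrow> admissible (\<lambda>v. k * F v)"
  unfolding admissible_def antilinear_def by (auto simp: algebra_simps) (metis mult_zero_right)

lemma encode_add: "encode (\<lambda>v. F v + G v) = encode F + encode G"
  and encode_scale: "encode (\<lambda>v. k * F v) = msm k (encode F)"
  and encode_zero: "encode (\<lambda>_. 0) = 0"
  by (auto simp: encode_def msm_def fun_eq_iff)

lemma encode_in_completion: "admissible F \<Longrightarrow> encode F \<in> completion"
  by (auto simp: completion_def)

lemma completionE:
  assumes "w \<in> completion"
  obtains F where "admissible F" "w = encode F"
  using assms by (auto simp: completion_def)

lemma subspace_completion: "msm.subspace completion"
  unfolding msm.subspace_def
proof (intro conjI ballI allI)
  show "0 \<in> completion"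
    using encode_in_completion[OF admissible_zero] by (simp add: encode_zero)
  fix w w' k assume w: "w \<in> completion" and w': "w' \<in> completion"
  obtain F where F: "admissible F" "w = encode F" using w by (rule completionE)
  obtain G where G: "admissible G" "w' = encode G" using w' by (rule completionE)
  show "w + w' \<in> completion"
    using encode_in_completion[OF admissible_add[OF F(1) G(1)]] by (simp add: F(2) G(2) encode_add)
next
  fix w k assume w: "w \<in> completion"
  obtain F where F: "admissible F" "w = encode F" using w by (rule completionE)
  show "msm k w \<in> completion"
    using encode_in_completion[OF admissible_scale[OF F(1)]] by (simp add: F(2) encode_scale)
qed

lemma adj_zero_left [simp]: "adj 0 n v = 0"
  using adj_scale_left[of 0 0 n v] by simp

text \<open>On Vle h the finitely many coefficients involved see F as the pairing with a vector of V, but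
  the length of the partial sums needed depends on that vector; truncation of F makes it uniform.\<close>
lemma Borcherds_functional:
  assumes F: "antilinear F" "\<exists>N. \<forall>n\<ge>N. \<forall>v. F (adj a n v) = 0" "\<exists>N. \<forall>n\<ge>N. \<forall>v. F (adj b n v) = 0"
  obtains N where "\<And>K v. K \<ge> N \<Longrightarrow>
     (\<Sum>i<K. ((of_int p :: complex) gchoose i) * F (adj (Y a (r + int i) b) (p + q - int i) v)) =
     (\<Sum>i<K. ((-1) ^ i * ((of_int r :: complex) gchoose i)) *
                 (F (adj b (q + int i) (adj a (p + r - int i) v))
                  - ((-1::complex) powi r) * F (adj a (p + int i) (adj b (q + r - int i) v))))"
proof -
  obtain N1 where N1: "\<And>n v. n \<ge> N1 \<Longrightarrow> F (adj a n v) = 0" using F(2) by blast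
  obtain N2 where N2: "\<And>n v. n \<ge> N2 \<Longrightarrow> F (adj b n v) = 0" using F(3) by blast
  obtain N3 where N3: "\<And>n. n \<ge> N3 \<Longrightarrow> Y a n b = 0" using Y_truncated by blast
  \<comment> \<open>From this \<open>i\<close> on each summand vanishes separately, for every
    \<open>v\<close>; hence all partial sums beyond \<open>N\<close> agree.\<close>
  define N where "N = nat \<bar>N1 - p\<bar> + nat \<bar>N2 - q\<bar> + nat \<bar>N3 - r\<bar>"
  define c where "c i = ((of_int p :: complex) gchoose i)" for i
  define c' where "c' i = (-1) ^ i * ((of_int r :: complex) gchoose i)" for i
  define \<epsilon> where "\<epsilon> = (-1::complex) powi r"
  define t where "t v i = sm (cnj (c i)) (adj (Y a (r + int i) b) (p + q - int i) v)
      - sm (cnj (c' i)) (adj b (q + int i) (adj a (p + r - int i) v) - sm (cnj \<epsilon>) (adj a (p + int i) (adj b (q + r - int i) v)))" for v i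
  have Ft: "F (t v i) = c i * F (adj (Y a (r + int i) b) (p + q - int i) v)
      - c' i * (F (adj b (q + int i) (adj a (p + r - int i) v)) - \<epsilon> * F (adj a (p + int i) (adj b (q + r - int i) v)))" for v i
    by (simp add: t_def antilinear_diff[OF F(1)] antilinear_scale[OF F(1)])
  have tail: "F (t v i) = 0" if "i \<ge> N" for v i
  proof -
    have "r + int i \<ge> N3" "q + int i \<ge> N2" "p + int i \<ge> N1" using that by (auto simp: N_def)
    then show ?thesis unfolding Ft by (simp add: N1 N2 N3 antilinear_zero[OF F(1)])
  qed
  have zero: "(\<Sum>i<K. F (t v i)) = 0" if "K \<ge> N" for K v
  proof -
    obtain h where h: "v \<in> VL h" using ex_Vle by blast
    \<comment> \<open>A level for all \<open>i\<close> at once: in the double products the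
      contributions of \<open>i\<close> cancel, and in the iterate \<open>i\<close> only lowers the
      energy.\<close>
    define H where "H = h + \<bar>p\<bar> + \<bar>q\<bar> + \<bar>r\<bar> + 2"
    have tH: "t v i \<in> VL H" for i
    proof -
      have up: "x \<in> VL k \<Longrightarrow> k \<le> H \<Longrightarrow> x \<in> VL H" for x k using Vle_mono by blast
      have "p \<le> \<bar>p\<bar>" "q \<le> \<bar>q\<bar>" "r \<le> \<bar>r\<bar>" "0 \<le> \<bar>r\<bar>" by simp_all
      then have le: "h + (p + q - int i) + 1 \<le> H" "h + (p + r - int i) + 1 + (q + int i) + 1 \<le> H"
        "h + (q + r - int i) + 1 + (p + int i) + 1 \<le> H"
        unfolding H_def by linarith+
      have "adj (Y a (r + int i) b) (p + q - int i) v \<in> VL H"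
        by (rule up[OF adj_Vle[OF h] le(1)])
      moreover have "adj b (q + int i) (adj a (p + r - int i) v) \<in> VL H"
        by (rule up[OF adj_Vle[OF adj_Vle[OF h]] le(2)])
      moreover have "adj a (p + int i) (adj b (q + r - int i) v) \<in> VL H"
        by (rule up[OF adj_Vle[OF adj_Vle[OF h]] le(3)])
      ultimately show ?thesis unfolding t_def
        by (intro subspace_diff[OF subspace_Vle] subspace_scale[OF subspace_Vle])
    qed
    obtain B where B: "finite B" "VL H \<subseteq> span B" using ex_finite_span_Vle by blast
    have ex: "\<forall>x. \<exists>L. \<forall>K\<ge>L. ip (\<Sum>i<K. t v i) x = 0"
    proof
      fix x
      obtain L where L: "\<And>K. K \<ge> L \<Longrightarrow>
         (\<Sum>i<K. sm (c i) (Y (Y a (r + int i) b) (p + q - int i) x)) =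
         (\<Sum>i<K. sm (c' i) (Y a (p + r - int i) (Y b (q + int i) x)
                      - sm \<epsilon> (Y b (q + r - int i) (Y a (p + int i) x))))"
        unfolding c_def c'_def \<epsilon>_def using Borcherds_sums[of p a r b q x] by blast
      have "ip (t v i) x = ip v (sm (c i) (Y (Y a (r + int i) b) (p + q - int i) x)
          - sm (c' i) (Y a (p + r - int i) (Y b (q + int i) x)
                      - sm \<epsilon> (Y b (q + r - int i) (Y a (p + int i) x))))" for i
        unfolding t_def ip_diff_left ip_diff_right ip_scale_left ip_scale_right ip_adj ..
      then have "ip (\<Sum>i<K. t v i) x = 0" if "K \<ge> L" for K
        by (simp only: ip_sum_left ip_sum_right[symmetric] sum_subtractf L[OF that]) simp
      then show "\<exists>L. \<forall>K\<ge>L. ip (\<Sum>i<K. t v i) x = 0" by blast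
    qed
    obtain L where L: "\<And>x K. K \<ge> L x \<Longrightarrow> ip (\<Sum>i<K. t v i) x = 0"
      using choice[OF ex] by blast
    \<comment> \<open>Beyond the thresholds of the finitely many vectors in \<open>B\<close>. The
      sum up to \<open>K'\<close> is then orthogonal to its whole energy level, itself included,
      hence zero; the terms between \<open>K\<close> and \<open>K'\<close> contribute nothing under
      \<open>F\<close>.\<close>
    define K' where "K' = K + (\<Sum>x\<in>B. L x)"
    have "ip (\<Sum>i<K'. t v i) y = 0" if "y \<in> span B" for y
      using that
    proof (induction rule: span_induct_alt)
      case (step k x y)
      have "L x \<le> (\<Sum>x\<in>B. L x)" using B(1) step(1) by (intro member_le_sum) auto
      then have "L x \<le> K'" by (simp add: K'_def)
      then show ?case using step by (simp add: ip_add_right ip_scale_right L)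
    qed simp
    moreover have "(\<Sum>i<K'. t v i) \<in> VL H" using tH by (intro subspace_sum[OF subspace_Vle])
    ultimately have "ip (\<Sum>i<K'. t v i) (\<Sum>i<K'. t v i) = 0" using B(2) by blast
    then have "(\<Sum>i<K'. t v i) = 0" by (simp only: ip_self_eq_0)
    then have "(\<Sum>i<K'. F (t v i)) = 0"
      using antilinear_sum[OF F(1), of "t v" "{..<K'}"] antilinear_zero[OF F(1)] by simp
    moreover have "(\<Sum>i<K'. F (t v i)) = (\<Sum>i<K. F (t v i))"
      using that by (intro sum.mono_neutral_right ballI tail) (auto simp: K'_def)
    ultimately show ?thesis by simp
  qed
  show ?thesis
  proof (rule that[of N])
    fix K v assume "K \<ge> N"
    from zero[OF this, of v] show "(\<Sum>i<K. ((of_int p :: complex) gchoose i) * F (adj (Y a (r + int i) b) (p + q - int i) v)) =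
     (\<Sum>i<K. ((-1) ^ i * ((of_int r :: complex) gchoose i)) *
                 (F (adj b (q + int i) (adj a (p + r - int i) v))
                  - ((-1::complex) powi r) * F (adj a (p + int i) (adj b (q + r - int i) v))))"
      unfolding Ft sum_subtractf right_minus_eq c_def c'_def \<epsilon>_def .
  qed
qed

text \<open>The commutator formula, r = 0: for large \<open>p\<close> the mode \<open>a_(p)\<close>
  commutes with \<open>u_(q)\<close> on \<open>F\<close> up to finitely many modes of a_(i) u, and
  all these terms vanish uniformly in \<open>v\<close>.\<close>

lemma admissible_act:
  assumes F: "admissible F" and u: "u \<in> U"
  shows "admissible (act u q F)"
  unfolding admissible_def
proof (intro conjI ballI antilinear_act admissible_antilinear F)
  fix a assume a: "a \<in> U"
  have antiF: "antilinear F" and tr: "\<And>x. x \<in> U \<Longrightarrow> \<exists>N. \<forall>n\<ge>N. \<forall>v. F (adj x n v) = 0"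
    using F by (auto simp: admissible_def)
  obtain T where T: "\<And>n. n \<ge> T \<Longrightarrow> Y a n u = 0" using Y_truncated by blast
  have "\<forall>i. \<exists>N. \<forall>n\<ge>N. \<forall>v. F (adj (Y a (int i) u) n v) = 0"
    using tr Y_in_U a u by blast
  from choice[OF this] obtain N where N: "\<And>i n v. n \<ge> N i \<Longrightarrow> F (adj (Y a (int i) u) n v) = 0" by blast
  obtain N1 where N1: "\<And>n v. n \<ge> N1 \<Longrightarrow> F (adj a n v) = 0" using tr[OF a] by blast
  \<comment> \<open>Large enough that p \<ge> N1 and p + q - i \<ge> N i for every \<open>i\<close>
    below the truncation \<open>T\<close>.\<close>
  define P where "P = \<bar>N1\<bar> + (\<Sum>i<nat T. \<bar>N i\<bar> + int i) + \<bar>q\<bar>"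
  show "\<exists>N. \<forall>n\<ge>N. \<forall>v. act u q F (adj a n v) = 0"
  proof (intro exI[of _ P] allI impI)
    fix p v assume p: "p \<ge> P"
    have Ppos: "0 \<le> (\<Sum>i<nat T. \<bar>N i\<bar> + int i)" by (rule sum_nonneg) simp
    obtain L where L: "\<And>K v. K \<ge> L \<Longrightarrow>
     (\<Sum>i<K. ((of_int p :: complex) gchoose i) * F (adj (Y a (0 + int i) u) (p + q - int i) v)) =
     (\<Sum>i<K. ((-1) ^ i * ((of_int 0 :: complex) gchoose i)) *
                 (F (adj u (q + int i) (adj a (p + 0 - int i) v))
                  - ((-1::complex) powi 0) * F (adj a (p + int i) (adj u (q + 0 - int i) v))))"
      using Borcherds_functional[OF antiF tr[OF a] tr[OF u], of p 0 q] by blast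
    have "(\<Sum>i<Suc L. ((of_int p :: complex) gchoose i) * F (adj (Y a (0 + int i) u) (p + q - int i) v)) = 0"
    proof (rule sum.neutral, rule ballI)
      fix i
      have "F (adj (Y a (int i) u) (p + q - int i) v) = 0"
      proof (cases "i < nat T")
        case True
        then have "\<bar>N i\<bar> + int i \<le> (\<Sum>i<nat T. \<bar>N i\<bar> + int i)"
          by (intro member_le_sum[of i "{..<nat T}" "\<lambda>i. \<bar>N i\<bar> + int i"]) auto
        then have "p + q - int i \<ge> N i" using p by (auto simp: P_def)
        then show ?thesis by (rule N)
      next
        case False
        then show ?thesis by (simp add: T antilinear_zero[OF antiF])
      qed
      then show "((of_int p :: complex) gchoose i) * F (adj (Y a (0 + int i) u) (p + q - int i) v) = 0" by simp
    qed
    then have "0 = (\<Sum>i<Suc L. ((-1) ^ i * ((of_int 0 :: complex) gchoose i)) *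
                 (F (adj u (q + int i) (adj a (p + 0 - int i) v))
                  - ((-1::complex) powi 0) * F (adj a (p + int i) (adj u (q + 0 - int i) v))))"
      by (subst (asm) L) simp_all
    also have "\<dots> = F (adj u q (adj a p v)) - F (adj a p (adj u q v))"
      unfolding sum.lessThan_Suc_shift by simp
    also have "F (adj a p (adj u q v)) = 0" using p Ppos by (intro N1) (auto simp: P_def)
    finally show "act u q F (adj a p v) = 0" by (simp add: act_def)
  qed
qed

lemma weak_module_completion: "weak_module sm Y vac U completion YC"
  unfolding weak_module_def
proof (intro conjI ballI allI)
  show "msm.subspace completion" by (rule subspace_completion)
  show "YC a n w \<in> completion" if "a \<in> U" "w \<in> completion" for a n w
    using that admissible_act unfolding completion_def by (auto simp: YC_encode)
  show "YC a n (w1 + w2) = YC a n w1 + YC a n w2" if w: "w1 \<in> completion" "w2 \<in> completion" for a n w1 w2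
  proof -
    obtain F G where F: "admissible F" "w1 = encode F" and G: "admissible G" "w2 = encode G"
      using w by (auto elim!: completionE)
    have "YC a n (w1 + w2) = encode (act a n (\<lambda>v. F v + G v))"
      using YC_encode[OF admissible_add[OF F(1) G(1)]] by (simp add: F(2) G(2) encode_add)
    then show ?thesis
      by (simp add: F G YC_encode) (simp add: encode_def act_def fun_eq_iff)
  qed
  show "YC a n (msm k w) = msm k (YC a n w)" if w: "w \<in> completion" for a n k w
  proof -
    obtain F where F: "admissible F" "w = encode F"
      using w by (rule completionE)
    have "YC a n (msm k w) = encode (act a n (\<lambda>v. k * F v))"
      using YC_encode[OF admissible_scale[OF F(1)]] by (simp add: F(2) encode_scale)
    then show ?thesis
      by (simp add: F YC_encode) (simp add: encode_def act_def msm_def fun_eq_iff)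
  qed
  show "YC (a1 + a2) n w = YC a1 n w + YC a2 n w" if w: "w \<in> completion" for a1 a2 n w
  proof -
    obtain F where F: "admissible F" "w = encode F"
      using w by (rule completionE)
    show ?thesis
      by (simp add: F YC_encode encode_def act_def fun_eq_iff adj_add_left
          antilinear_add[OF admissible_antilinear[OF F(1)]])
  qed
  show "YC (sm k a) n w = msm k (YC a n w)" if w: "w \<in> completion" for a n k w
  proof -
    obtain F where F: "admissible F" "w = encode F"
      using w by (rule completionE)
    show ?thesis
      by (simp add: F YC_encode encode_def act_def msm_def fun_eq_iff adj_scale_left
          antilinear_scale[OF admissible_antilinear[OF F(1)]])
  qed
  show "\<exists>N. \<forall>n\<ge>N. YC a n w = 0" if "a \<in> U" and w: "w \<in> completion" for a w
  proof -
    obtain F where F: "admissible F" "w = encode F"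
      using w by (rule completionE)
    have "\<exists>N. \<forall>n\<ge>N. \<forall>v. F (adj a n v) = 0"
      using F(1) that(1) by (simp add: admissible_def)
    then obtain N where N: "\<And>n v. n \<ge> N \<Longrightarrow> F (adj a n v) = 0" by blast
    have "YC a n w = 0" if "n \<ge> N" for n
      unfolding F(2) YC_encode[OF F(1)] by (simp add: encode_def act_def fun_eq_iff N that)
    then show ?thesis by blast
  qed
  show "YC vac n w = (if n = - 1 then w else 0)" if w: "w \<in> completion" for n w
  proof -
    obtain F where F: "admissible F" "w = encode F"
      using w by (rule completionE)
    show ?thesis
    proof (cases "n = - 1")
      case True
      then have "act vac n F = F" by (intro ext) (simp add: act_def adj_vac)
      then show ?thesis using YC_encode[OF F(1), of vac n] True F(2) by simp
    next
      case False
      then have "act vac n F = (\<lambda>_. 0)"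
        by (intro ext) (simp add: act_def adj_vac antilinear_zero[OF admissible_antilinear[OF F(1)]])
      then show ?thesis using YC_encode[OF F(1), of vac n] False F(2) by (simp add: encode_zero)
    qed
  qed
  show "borcherds_identity msm Y YC a b w p q r"
    if ab: "a \<in> U" "b \<in> U" and w: "w \<in> completion" for a b w p q r
  proof -
    obtain F where F: "admissible F" "w = encode F"
      using w by (rule completionE)
    obtain N where N: "\<And>K v. K \<ge> N \<Longrightarrow>
     (\<Sum>i<K. ((of_int p :: complex) gchoose i) * F (adj (Y a (r + int i) b) (p + q - int i) v)) =
     (\<Sum>i<K. ((-1) ^ i * ((of_int r :: complex) gchoose i)) *
                 (F (adj b (q + int i) (adj a (p + r - int i) v))
                  - ((-1::complex) powi r) * F (adj a (p + int i) (adj b (q + r - int i) v))))"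
      using Borcherds_functional[of F a b p r q] F(1) ab unfolding admissible_def by blast
    have 1: "YC x n w = encode (act x n F)" for x n by (simp add: F YC_encode)
    have 2: "YC y m (encode (act x n F)) = encode (act y m (act x n F))" if "x \<in> U" for x y m n
      by (rule YC_encode[OF admissible_act[OF F(1) that]])
    \<comment> \<open>Since the threshold \<open>N\<close> does not depend on \<open>v\<close>, the
      two sides agree as functions of the index of the spanning sequence.\<close>
    show ?thesis
      unfolding borcherds_identity_def borcherds_sums_def fst_conv snd_conv 1 2[OF ab(1)] 2[OF ab(2)]
      using N by (intro exI[of _ N]) (simp add: fun_eq_iff sum_fun_apply' msm_def encode_def act_def)
  qed
qed

section \<open>Regularity leaves only finitely many lowest weights\<close>

lemma finite_lowest_weight:
  assumes reg: "regular_voa sm Y vac nu U"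
  shows "finite {h. \<not> lowest_weight h \<subseteq> {0}}"
proof -
  let ?hs = "{h. \<not> lowest_weight h \<subseteq> {0}}"
  have "\<forall>h\<in>?hs. \<exists>w. w \<in> lowest_weight h \<and> w \<noteq> 0" by blast
  from bchoice[OF this] obtain w where w: "\<And>h. h \<in> ?hs \<Longrightarrow> w h \<in> lowest_weight h" "\<And>h. h \<in> ?hs \<Longrightarrow> w h \<noteq> 0" by blast
  define F where "F v = (\<Sum>h\<in>?hs \<inter> {d. dec v d \<noteq> 0}. ip (w h) (dec v h))" for v
  have F_sup: "F v = (\<Sum>h\<in>?hs \<inter> S. ip (w h) (dec v h))" if "finite S" "{d. dec v d \<noteq> 0} \<subseteq> S" for v S
    unfolding F_def using that by (intro sum.mono_neutral_left) auto
  have antiF: "antilinear F" unfolding antilinear_def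
  proof (intro conjI allI)
    fix x y
    let ?S = "{d. dec x d \<noteq> 0} \<union> {d. dec y d \<noteq> 0}"
    have *: "F z = (\<Sum>h\<in>?hs \<inter> ?S. ip (w h) (dec z h))" if "z \<in> {x, y, x + y}" for z
      using that by (intro F_sup) (auto simp: finite_dec dec_add)
    show "F (x + y) = F x + F y"
      using *[of x] *[of y] *[of "x + y"] by (simp add: dec_add ip_add_right sum.distrib)
  next
    fix k x
    let ?S = "{d. dec x d \<noteq> 0}"
    have "F (sm k x) = (\<Sum>h\<in>?hs \<inter> ?S. ip (w h) (dec (sm k x) h))"
      by (rule F_sup) (auto simp: finite_dec dec_scale)
    then show "F (sm k x) = cnj k * F x"
      by (simp add: F_def dec_scale ip_scale_right sum_distrib_left)
  qed
  have ip_dec: "ip (w h) (dec v h) = ip (w h) v" if "h \<in> ?hs" for h v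
  proof -
    have "ip (w h) v = (\<Sum>d\<in>{d. dec v d \<noteq> 0}. ip (w h) (dec v d))"
      by (subst dec_sum[of v]) (rule ip_sum_right)
    also have "\<dots> = (\<Sum>d\<in>{d. dec v d \<noteq> 0} \<inter> {h}. ip (w h) (dec v d))"
      using w(1)[OF that] by (intro sum.mono_neutral_right)
        (auto simp: finite_dec lowest_weight_def intro: grade_orthogonal[OF _ dec_grade])
    also have "\<dots> = ip (w h) (dec v h)" by (cases "dec v h = 0") auto
    finally show ?thesis by simp
  qed
  have admF: "admissible F" unfolding admissible_def
  proof (intro conjI antiF ballI)
    fix u assume u: "u \<in> U"
    \<comment> \<open>The heart of admissibility: from index \<open>D\<close> on, the modes of
      \<open>u\<close> lower weights and therefore kill all the \<open>w h\<close> simultaneously,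
      with \<open>D\<close> depending on \<open>u\<close> only.\<close>
    obtain D where D: "\<And>d. dec u d \<noteq> 0 \<Longrightarrow> d \<le> D" using ex_dec_bound by blast
    have "Y u n (w h) = 0" if "h \<in> ?hs" "n \<ge> D" for n h
    proof -
      have "Y (dec u d) n (w h) = 0" if "dec u d \<noteq> 0" for d
        using w(1)[OF \<open>h \<in> ?hs\<close>] D[OF that] \<open>n \<ge> D\<close> dec_in_U[OF u] dec_grade[of u d]
        unfolding lowest_weight_def by fastforce
      then show ?thesis by (subst dec_sum[of u]) (simp add: Y_sum_left)
    qed
    then have "F (adj u n v) = 0" if "n \<ge> D" for n v
      unfolding F_def using that by (intro sum.neutral) (simp add: ip_dec ip_adj_right)
    then show "\<exists>N. \<forall>n\<ge>N. \<forall>v. F (adj u n v) = 0" by blast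
  qed
  have Fw: "F (w h) \<noteq> 0" if "h \<in> ?hs" for h
  proof -
    have wh: "w h \<in> V h" using w(1)[OF that] by (simp add: lowest_weight_def)
    have "F (w h) = (\<Sum>h'\<in>?hs \<inter> {h}. ip (w h') (dec (w h) h'))"
      by (rule F_sup) (auto simp: dec_homogeneous[OF wh])
    then have "F (w h) = ip (w h) (w h)" using that by (simp add: dec_homogeneous[OF wh])
    then show ?thesis using w(2)[OF that] by simp
  qed
  \<comment> \<open>\<open>Q\<close> says that only finitely many weights are involved. It holds on
    L_0-eigenvectors, which can be nonzero only on the weight equal to the eigenvalue, and passes to
    their span; \<open>F\<close> is nonzero on each \<open>w h\<close>.\<close>
  define Q where "Q x \<longleftrightarrow> (\<exists>G. admissible G \<and> x = encode G \<and> finite {h. \<exists>v\<in>V h. G v \<noteq> 0})" for x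
  define E where "E = {f \<in> completion. \<exists>l. YC nu 1 f = msm l f}"
  have QE: "Q f" if fE: "f \<in> E" for f
  proof -
    obtain G l where G: "admissible G" "f = encode G" and l: "YC nu 1 f = msm l f"
      using fE unfolding E_def completion_def by blast
    have "encode (act nu 1 G) = encode (\<lambda>v. l * G v)"
      using l by (simp add: G YC_encode encode_scale)
    then have "act nu 1 G = (\<lambda>v. l * G v)"
      by (intro encode_inject antilinear_act admissible_antilinear admissible_scale G(1))
    then have eig: "G (Y nu 1 v) = l * G v" for v by (auto simp: act_def adj_nu fun_eq_iff)
    have "of_int h = l" if "v \<in> V h" "G v \<noteq> 0" for v h
      using that eig[of v] antilinear_scale[OF admissible_antilinear[OF G(1)], of "of_int h" v]
      by (simp add: mem_grade)
    then have "{h. \<exists>v\<in>V h. G v \<noteq> 0} \<subseteq> {h. of_int h = l}" by blast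
    moreover have "finite {h::int. of_int h = l}"
    proof (cases "\<exists>h::int. of_int h = l")
      case True
      then obtain h0 :: int where "of_int h0 = l" by blast
      then have "{h::int. of_int h = l} = {h0}" by auto
      then show ?thesis by simp
    qed simp
    ultimately show ?thesis unfolding Q_def using G finite_subset by blast
  qed
  have QS: "Q x" if "x \<in> msm.span E" for x
    using that
  proof (induction rule: msm.span_induct_alt)
    case base
    show ?case unfolding Q_def
      using admissible_zero encode_zero by (intro exI[of _ "\<lambda>_. 0"]) simp
  next
    case (step c x y)
    obtain G1 where G1: "admissible G1" "x = encode G1" "finite {h. \<exists>v\<in>V h. G1 v \<noteq> 0}"
      using QE[OF step(1)] unfolding Q_def by blast
    obtain G2 where G2: "admissible G2" "y = encode G2" "finite {h. \<exists>v\<in>V h. G2 v \<noteq> 0}"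
      using step(2) unfolding Q_def by blast
    have "finite {h. \<exists>v\<in>V h. c * G1 v + G2 v \<noteq> 0}"
      by (rule finite_subset[OF _ finite_UnI[OF G1(3) G2(3)]]) auto
    moreover have "admissible (\<lambda>v. c * G1 v + G2 v)"
      by (intro admissible_add admissible_scale G1 G2)
    moreover have "msm c x + y = encode (\<lambda>v. c * G1 v + G2 v)"
      by (simp add: G1 G2 encode_add encode_scale)
    ultimately show ?case unfolding Q_def by blast
  qed
  have "direct_sum_irreducible_ordinary sm Y vac nu U completion YC"
    using reg weak_module_completion unfolding regular_voa_def by blast
  then obtain Ms where Ms: "\<And>N. N \<in> Ms \<Longrightarrow> submodule U completion YC N \<and> ordinary_module sm Y vac nu U N YC"
    and span: "msm.span (\<Union>Ms) = completion"
    unfolding direct_sum_irreducible_ordinary_def by blast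
  have "N \<subseteq> msm.span E" if N: "N \<in> Ms" for N
  proof
    fix x assume x: "x \<in> N"
    have sub: "N \<subseteq> completion" using Ms[OF N] by (simp add: submodule_def)
    have "ordinary_module sm Y vac nu U N YC" using Ms[OF N] by simp
    then obtain f :: "complex \<Rightarrow> nat \<Rightarrow> complex" where f: "\<And>l. f l \<in> N \<and> YC nu 1 (f l) = msm l (f l)" "x = sum f {l. f l \<noteq> 0}"
      using x unfolding ordinary_module_def by blast
    show "x \<in> msm.span E" unfolding f(2)
      using f(1) sub by (intro msm.span_sum msm.span_base) (auto simp: E_def)
  qed
  then have "completion \<subseteq> msm.span E"
    unfolding span[symmetric] by (intro msm.span_minimal msm.subspace_span) blast
  then have "Q (encode F)" using QS admF by (auto simp: completion_def)
  then obtain G where G: "admissible G" "encode F = encode G" "finite {h. \<exists>v\<in>V h. G v \<noteq> 0}"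
    unfolding Q_def by blast
  then have "F = G" using encode_inject[OF antiF admissible_antilinear[OF G(1)]] by blast
  then have "finite {h. \<exists>v\<in>V h. F v \<noteq> 0}" using G(3) by simp
  moreover have "?hs \<subseteq> {h. \<exists>v\<in>V h. F v \<noteq> 0}"
    using Fw w(1) unfolding lowest_weight_def by blast
  ultimately show ?thesis by (rule finite_subset[rotated])
qed

end

theorem mainTheorem12:
  fixes sm :: "complex \<Rightarrow> 'v::ab_group_add \<Rightarrow> 'v"
    and Y :: "'v \<Rightarrow> int \<Rightarrow> 'v \<Rightarrow> 'v"
    and vac nu :: 'v
    and ip :: "'v \<Rightarrow> 'v \<Rightarrow> complex"
    and star :: "'v \<Rightarrow> 'v"
    and U :: "'v set"
  assumes "simple_unitary_voa sm Y vac nu ip star"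
    and "energy_bounded_subalgebra sm Y vac nu ip star U"
    and "nu \<in> U"
    and "regular_voa sm Y vac nu U"
  shows "energy_bounded_voa sm Y nu ip"
proof -
  interpret energy_bounded_sub sm Y vac nu ip star U
    by unfold_locales (use assms in \<open>simp_all add: simple_unitary_voa_def\<close>)
  obtain H where "\<And>h. \<not> lowest_weight h \<subseteq> {0} \<Longrightarrow> h \<le> H"
    using finite_lowest_weight[OF assms(4)] bdd_above_finite by (fastforce simp: bdd_above_def)
  then obtain A where "finite A" "generates A"
    using ex_finite_generators[of H] by fastforce
  then show ?thesis
    unfolding energy_bounded_voa_def
    using poly_bounded_if_finitely_generated energy_bounds_if_poly_bounded by blast
qed

end
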